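(* Assume $\mathsf{CH}$, and suppose that for every collection $\mathcal{X}$ of size $\omega_2$ of regressive functions from $\omega_2$ to $\omega_2$ and every $\alpha<\omega_1$, there exists a ${<}\,\omega_2$-complete ideal $I_{\mathcal{X}}$ on $\omega_2$ such that $E^{\omega_2}_\omega\in I_{\mathcal{X}}$ and player II has a winning strategy in the game $\Game^{\alpha}(I_{\mathcal{X}},\mathcal{X})$. Let $f\colon[\omega_2]^2\to\omega_2$ be a normal, $\omega$-bounded coloring. Then there is a poset $\mathbb{P}_f$ such that: (1) $\mathbb{P}_f$ is countably closed; (2) $\mathbb{P}_f$ preserves $\omega_2^V$ (as a cardinal); (3) $\mathbb{P}_f$ adds a total function $l\colon\omega_2\to\omega_1$ such that for every $i<\omega_1$, $l^{-1}[\{i\}]$ is $f$-rainbow.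
   Context: $E^{\omega_2}_\omega$ is the set of ordinals below $\omega_2$ of cofinality $\omega$. A function $g\colon\omega_2\to\omega_2$ is regressive if $g(\eta)<\eta$ for all $\eta>0$. A coloring $f\colon[\omega_2]^2\to\omega_2$ is $\omega$-bounded if every fiber $f^{-1}[\{\alpha\}]$ is countable, and normal if whenever $f(a)=f(b)$ for $a,b\in[\omega_2]^2$ then $\max a=\max b$. A set $A$ is $f$-rainbow if $f\restriction[A]^2$ is injective. For $I$ an ideal on $\omega_2$, $I^+$ denotes the family of subsets of $\omega_2$ not in $I$. For a ${<}\,\omega_2$-complete ideal $I$ on $\omega_2$, $\alpha<\omega_1$, and a set $\mathcal{X}$ of regressive functions on $\omega_2$, the game $\Game^{\alpha}(I,\mathcal{X})$ lasts $\alpha$ rounds, player I starting: in round $\beta<\alpha$ player I plays $f_\beta\in\mathcal{X}$ and player II responds with an ordinal $\xi_\beta<\omega_2$. Player II wins iff there is $X\in I^+$ such that $f_\beta(\eta)<\xi_\beta$ for every $\eta\in X$ and every $\beta<\alpha$. *)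

theory Defs
  imports "HOL-Library.FuncSet" "HOL-Library.Countable_Set"
begin

unbundle cardinal_syntax

section \<open>The ordinals \<open>\<omega>\<^sub>1\<close> and \<open>\<omega>\<^sub>2\<close>\<close>

text \<open>
  \<open>cardSuc r\<close> is a cardinal order, i.e. a well-order of minimal order type for its cardinality.
  So the types below, with the inherited orders, are isomorphic to \<open>\<omega>\<^sub>1\<close> and \<open>\<omega>\<^sub>2\<close>; their
  elements stand for the ordinals below \<open>\<omega>\<^sub>1\<close> and below \<open>\<omega>\<^sub>2\<close>, and an ordinal \<open>\<alpha>\<close> is identified
  with \<open>{..<\<alpha>}\<close>.
\<close>

lemma Well_order_typedef_wellorder:
  fixes R :: "'b rel" and rep :: "'a \<Rightarrow> 'b"
  assumes wo: "Well_order R" and inj: "inj rep" and ran: "range rep \<subseteq> Field R"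
  defines "le \<equiv> (\<lambda>x y. (rep x, rep y) \<in> R)"
  shows "le x x" "le x y \<Longrightarrow> le y z \<Longrightarrow> le x z" "le x y \<Longrightarrow> le y x \<Longrightarrow> x = y"
    "le x y \<or> le y x" "(\<And>x. (\<And>y. le y x \<Longrightarrow> \<not> le x y \<Longrightarrow> Q y) \<Longrightarrow> Q x) \<Longrightarrow> Q a"
proof -
  have f: "rep u \<in> Field R" for u
    using ran by blast
  have lin: "refl_on (Field R) R" "trans R" "antisym R" "total_on (Field R) R" "wf (R - Id)"
    using wo by (auto simp: order_on_defs)
  show "le x x"
    using lin(1) f by (auto simp: le_def refl_on_def)
  show "le x y \<Longrightarrow> le y z \<Longrightarrow> le x z"
    using lin(2) by (auto simp: le_def dest: transD)
  show as: "le x y \<Longrightarrow> le y x \<Longrightarrow> x = y" for x y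
    using lin(3) inj by (auto simp: le_def dest: antisymD injD)
  show "le x y \<or> le y x"
    using lin(1,4) f[of x] f[of y] by (cases "rep x = rep y")
      (auto simp: le_def refl_on_def total_on_def)
  show "Q a" if step: "\<And>x. (\<And>y. le y x \<Longrightarrow> \<not> le x y \<Longrightarrow> Q y) \<Longrightarrow> Q x"
  proof -
    have "wf (inv_image (R - Id) rep)"
      using lin(5) by (rule wf_inv_image)
    then show ?thesis
    proof (induction a rule: wf_induct_rule)
      case (less x)
      show ?case
      proof (rule step)
        fix y assume "le y x" "\<not> le x y"
        then have "(y, x) \<in> inv_image (R - Id) rep"
          by (auto simp: le_def in_inv_image)
        then show "Q y" by (rule less)
      qed
    qed
  qed
qed

typedef omega1 = "Field (cardSuc natLeq)"
  using Field_cardSuc_not_empty[OF natLeq_Card_order] by blast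

typedef omega2 = "Field (cardSuc (cardSuc natLeq))"
  using Field_cardSuc_not_empty[OF cardSuc_Card_order[OF natLeq_Card_order]] by blast

lemma Well_order_cardSuc_natLeq:
  "Well_order (cardSuc natLeq)" "Well_order (cardSuc (cardSuc natLeq))"
  using natLeq_Card_order by (simp_all add: cardSuc_Card_order card_order_on_well_order_on)

instantiation omega1 :: wellorder
begin

definition less_eq_omega1 :: "omega1 \<Rightarrow> omega1 \<Rightarrow> bool" where
  "x \<le> (y :: omega1) \<longleftrightarrow> (Rep_omega1 x, Rep_omega1 y) \<in> cardSuc natLeq"

definition less_omega1 :: "omega1 \<Rightarrow> omega1 \<Rightarrow> bool" where
  "x < (y :: omega1) \<longleftrightarrow> x \<le> y \<and> \<not> y \<le> x"

instance
proof -
  have inj: "inj Rep_omega1"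
    by (simp add: inj_on_def Rep_omega1_inject)
  have ran: "range Rep_omega1 \<subseteq> Field (cardSuc natLeq)"
    using Rep_omega1 by blast
  note W = Well_order_typedef_wellorder[OF Well_order_cardSuc_natLeq(1) inj ran,
      folded less_eq_omega1_def]
  show "OFCLASS(omega1, wellorder_class)"
  proof
    fix Q :: "omega1 \<Rightarrow> bool" and a
    assume step: "\<And>x. (\<And>y. y < x \<Longrightarrow> Q y) \<Longrightarrow> Q x"
    show "Q a"
      by (rule W(5), rule step) (simp add: less_omega1_def)
  qed (use W(1-4) in \<open>auto simp: less_omega1_def\<close>)
qed

end

instantiation omega2 :: wellorder
begin

definition less_eq_omega2 :: "omega2 \<Rightarrow> omega2 \<Rightarrow> bool" where
  "x \<le> (y :: omega2) \<longleftrightarrow> (Rep_omega2 x, Rep_omega2 y) \<in> cardSuc (cardSuc natLeq)"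

definition less_omega2 :: "omega2 \<Rightarrow> omega2 \<Rightarrow> bool" where
  "x < (y :: omega2) \<longleftrightarrow> x \<le> y \<and> \<not> y \<le> x"

instance
proof -
  have inj: "inj Rep_omega2"
    by (simp add: inj_on_def Rep_omega2_inject)
  have ran: "range Rep_omega2 \<subseteq> Field (cardSuc (cardSuc natLeq))"
    using Rep_omega2 by blast
  note W = Well_order_typedef_wellorder[OF Well_order_cardSuc_natLeq(2) inj ran,
      folded less_eq_omega2_def]
  show "OFCLASS(omega2, wellorder_class)"
  proof
    fix Q :: "omega2 \<Rightarrow> bool" and a
    assume step: "\<And>x. (\<And>y. y < x \<Longrightarrow> Q y) \<Longrightarrow> Q x"
    show "Q a"
      by (rule W(5), rule step) (simp add: less_omega2_def)
  qed (use W(1-4) in \<open>auto simp: less_omega2_def\<close>)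
qed

end

instantiation omega2 :: zero
begin

definition zero_omega2 :: omega2 where
  "(0 :: omega2) = (LEAST x. True)"

instance ..

end

definition CH :: bool where
  "CH \<longleftrightarrow> |UNIV :: nat set set| =o cardSuc natLeq"

definition E_omega :: "omega2 set" where
  "E_omega = {\<eta>. \<exists>s :: nat \<Rightarrow> omega2.
     strict_mono s \<and> (\<forall>n. s n < \<eta>) \<and> (\<forall>\<zeta><\<eta>. \<exists>n. \<zeta> < s n)}"

definition regressive :: "(omega2 \<Rightarrow> omega2) \<Rightarrow> bool" where
  "regressive g \<longleftrightarrow> (\<forall>\<eta>>0. g \<eta> < \<eta>)"


section \<open>Colorings of pairs\<close>

definition pairs :: "'a set \<Rightarrow> 'a set set" where
  "pairs A = {a. a \<subseteq> A \<and> card a = 2}"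

text \<open>
  A coloring \<open>f : [\<omega>\<^sub>2]\<^sup>2 \<rightarrow> \<omega>\<^sub>2\<close> is a function on \<open>omega2 set\<close> of which only the values on
  \<open>pairs UNIV\<close> matter.
\<close>

definition omega_bounded :: "(omega2 set \<Rightarrow> omega2) \<Rightarrow> bool" where
  "omega_bounded f \<longleftrightarrow> (\<forall>\<alpha>. countable {a \<in> pairs UNIV. f a = \<alpha>})"

definition normal_coloring :: "(omega2 set \<Rightarrow> omega2) \<Rightarrow> bool" where
  "normal_coloring f \<longleftrightarrow> (\<forall>a\<in>pairs UNIV. \<forall>b\<in>pairs UNIV. f a = f b \<longrightarrow> Max a = Max b)"

definition rainbow :: "(omega2 set \<Rightarrow> omega2) \<Rightarrow> omega2 set \<Rightarrow> bool" where
  "rainbow f A \<longleftrightarrow> inj_on f (pairs A)"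

text \<open>The form that is translated into the forcing language in \<open>f_rainbow\<close> below:\<close>

lemma rainbow_iff:
  "rainbow f A \<longleftrightarrow>
     (\<forall>a\<in>pairs UNIV. \<forall>b\<in>pairs UNIV.
        (\<forall>x\<in>a. x \<in> A) \<and> (\<forall>x\<in>b. x \<in> A) \<and> f a = f b \<longrightarrow> a = b)"
  by (auto simp: rainbow_def inj_on_def pairs_def subset_iff)


section \<open>Ideals and the game\<close>

text \<open>
  Ideals on \<open>\<omega>\<^sub>2\<close> are, as usual, proper and contain all singletons. (If singletons were not
  required, a principal ideal at a point of cofinality \<open>\<omega>\<^sub>1\<close> would make the game trivial
  for player II.)
\<close>

definition ideal_on_omega2 :: "omega2 set set \<Rightarrow> bool" where
  "ideal_on_omega2 I \<longleftrightarrow>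
     {} \<in> I \<and> UNIV \<notin> I \<and> (\<forall>\<eta>. {\<eta>} \<in> I) \<and>
     (\<forall>A\<in>I. \<forall>B. B \<subseteq> A \<longrightarrow> B \<in> I) \<and>
     (\<forall>A\<in>I. \<forall>B\<in>I. A \<union> B \<in> I)"

definition lt_omega2_complete :: "omega2 set set \<Rightarrow> bool" where
  "lt_omega2_complete I \<longleftrightarrow>
     (\<forall>\<A>. \<A> \<subseteq> I \<and> |\<A>| <o |UNIV :: omega2 set| \<longrightarrow> \<Union>\<A> \<in> I)"

text \<open>
  A strategy for player II maps the current round \<open>\<beta>\<close>, player I's moves up to and including
  round \<open>\<beta>\<close> and player II's own earlier moves to an ordinal.
\<close>

type_synonym strategy_II =
  "omega1 \<Rightarrow> (omega1 \<Rightarrow> omega2 \<Rightarrow> omega2) \<Rightarrow> (omega1 \<Rightarrow> omega2) \<Rightarrow> omega2"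

definition follows ::
  "strategy_II \<Rightarrow> omega1 \<Rightarrow> (omega1 \<Rightarrow> omega2 \<Rightarrow> omega2) \<Rightarrow> (omega1 \<Rightarrow> omega2) \<Rightarrow> bool" where
  "follows \<sigma> \<alpha> F \<xi> \<longleftrightarrow> (\<forall>\<beta><\<alpha>. \<xi> \<beta> = \<sigma> \<beta> (restrict F {..\<beta>}) (restrict \<xi> {..<\<beta>}))"

definition II_wins_run ::
  "omega2 set set \<Rightarrow> omega1 \<Rightarrow> (omega1 \<Rightarrow> omega2 \<Rightarrow> omega2) \<Rightarrow> (omega1 \<Rightarrow> omega2) \<Rightarrow> bool" where
  "II_wins_run I \<alpha> F \<xi> \<longleftrightarrow> (\<exists>X. X \<notin> I \<and> (\<forall>\<eta>\<in>X. \<forall>\<beta><\<alpha>. F \<beta> \<eta> < \<xi> \<beta>))"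

definition II_has_winning_strategy ::
  "omega1 \<Rightarrow> omega2 set set \<Rightarrow> (omega2 \<Rightarrow> omega2) set \<Rightarrow> bool" where
  "II_has_winning_strategy \<alpha> I \<X> \<longleftrightarrow>
     (\<exists>\<sigma>. \<forall>F \<xi>. (\<forall>\<beta><\<alpha>. F \<beta> \<in> \<X>) \<and> follows \<sigma> \<alpha> F \<xi> \<longrightarrow> II_wins_run I \<alpha> F \<xi>)"


section \<open>Forcing\<close>

text \<open>
  A forcing poset is a nonempty partial order \<open>r\<close> with underlying set \<open>Field r\<close>;
  \<open>(q, p) \<in> r\<close> means \<open>q \<le> p\<close>, i.e. \<open>q\<close> is the stronger condition.
\<close>

definition forcing_poset :: "'p rel \<Rightarrow> bool" where
  "forcing_poset r \<longleftrightarrow> Partial_order r \<and> Field r \<noteq> {}"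

definition countably_closed :: "'p rel \<Rightarrow> bool" where
  "countably_closed r \<longleftrightarrow>
     (\<forall>s :: nat \<Rightarrow> 'p. (\<forall>n. s n \<in> Field r) \<and> (\<forall>n. (s (Suc n), s n) \<in> r) \<longrightarrow>
        (\<exists>q. \<forall>n. (q, s n) \<in> r))"

text \<open>
  Statements of the forcing language are represented by the predicate \<open>\<lambda>p. p \<tturnstile> \<phi>\<close> on
  conditions, built by the usual recursive clauses for \<open>\<not>\<close>, \<open>\<and>\<close>, \<open>\<forall>\<close>; the other connectives are
  the classical abbreviations. Quantifiers here range over ground model sets \<open>A\<close>, so
  \<open>p\<close> forces \<open>\<forall>x \<in> A. \<phi>(x)\<close> iff it forces \<open>\<phi>(a)\<close> for every \<open>a \<in> A\<close>. Elements of the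
  ground model stand for their canonical (check) names.

  A name for a subset of a ground model set \<open>A\<close> is a set \<open>\<tau>\<close> of pairs \<open>(a, s)\<close> with
  \<open>a \<in> A\<close> and \<open>s\<close> a condition; every subset of \<open>A\<close> in the extension has such a name. As usual,
  \<open>p \<tturnstile> a \<in> \<tau>\<close> iff \<open>{q. \<exists>s. (a, s) \<in> \<tau> \<and> q \<le> s}\<close> is dense below \<open>p\<close>.
\<close>

type_synonym 'p fstmt = "'p \<Rightarrow> bool"
type_synonym ('a, 'p) subset_name = "('a \<times> 'p) set"

definition f_ground :: "bool \<Rightarrow> 'p fstmt" where
  "f_ground b p \<longleftrightarrow> b"

definition f_mem :: "'p rel \<Rightarrow> 'a \<Rightarrow> ('a, 'p) subset_name \<Rightarrow> 'p fstmt" where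
  "f_mem r a \<tau> p \<longleftrightarrow>
     (\<forall>q. (q, p) \<in> r \<longrightarrow> (\<exists>q'. (q', q) \<in> r \<and> (\<exists>s. (a, s) \<in> \<tau> \<and> (q', s) \<in> r)))"

definition f_not :: "'p rel \<Rightarrow> 'p fstmt \<Rightarrow> 'p fstmt" where
  "f_not r \<phi> p \<longleftrightarrow> (\<forall>q. (q, p) \<in> r \<longrightarrow> \<not> \<phi> q)"

definition f_and :: "'p fstmt \<Rightarrow> 'p fstmt \<Rightarrow> 'p fstmt" where
  "f_and \<phi> \<psi> p \<longleftrightarrow> \<phi> p \<and> \<psi> p"

definition f_all :: "'a set \<Rightarrow> ('a \<Rightarrow> 'p fstmt) \<Rightarrow> 'p fstmt" where
  "f_all A \<Phi> p \<longleftrightarrow> (\<forall>a\<in>A. \<Phi> a p)"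

definition f_imp :: "'p rel \<Rightarrow> 'p fstmt \<Rightarrow> 'p fstmt \<Rightarrow> 'p fstmt" where
  "f_imp r \<phi> \<psi> = f_not r (f_and \<phi> (f_not r \<psi>))"

definition f_ex :: "'p rel \<Rightarrow> 'a set \<Rightarrow> ('a \<Rightarrow> 'p fstmt) \<Rightarrow> 'p fstmt" where
  "f_ex r A \<Phi> = f_not r (f_all A (\<lambda>a. f_not r (\<Phi> a)))"

definition forced :: "'p rel \<Rightarrow> 'p fstmt \<Rightarrow> bool" where
  "forced r \<phi> \<longleftrightarrow> (\<forall>p\<in>Field r. \<phi> p)"

text \<open>``\<open>\<tau> \<inter> (A \<times> B)\<close> is (the graph of) a total function from \<open>A\<close> to \<open>B\<close>''\<close>

definition f_function ::
  "'p rel \<Rightarrow> 'a set \<Rightarrow> 'b set \<Rightarrow> ('a \<times> 'b, 'p) subset_name \<Rightarrow> 'p fstmt" where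
  "f_function r A B \<tau> = f_all A (\<lambda>x.
     f_and (f_ex r B (\<lambda>y. f_mem r (x, y) \<tau>))
       (f_all B (\<lambda>y. f_all B (\<lambda>z.
          f_imp r (f_and (f_mem r (x, y) \<tau>) (f_mem r (x, z) \<tau>)) (f_ground (y = z))))))"

definition f_injective ::
  "'p rel \<Rightarrow> 'a set \<Rightarrow> 'b set \<Rightarrow> ('a \<times> 'b, 'p) subset_name \<Rightarrow> 'p fstmt" where
  "f_injective r A B \<tau> = f_all A (\<lambda>x. f_all A (\<lambda>x'. f_all B (\<lambda>y.
     f_imp r (f_and (f_mem r (x, y) \<tau>) (f_mem r (x', y) \<tau>)) (f_ground (x = x')))))"

definition f_surjective ::
  "'p rel \<Rightarrow> 'a set \<Rightarrow> 'b set \<Rightarrow> ('a \<times> 'b, 'p) subset_name \<Rightarrow> 'p fstmt" where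
  "f_surjective r A B \<tau> = f_all B (\<lambda>y. f_ex r A (\<lambda>x. f_mem r (x, y) \<tau>))"

definition f_bijection ::
  "'p rel \<Rightarrow> 'a set \<Rightarrow> 'b set \<Rightarrow> ('a \<times> 'b, 'p) subset_name \<Rightarrow> 'p fstmt" where
  "f_bijection r A B \<tau> =
     f_and (f_function r A B \<tau>) (f_and (f_injective r A B \<tau>) (f_surjective r A B \<tau>))"

text \<open>
  It is forced that \<open>\<omega>\<^sub>2\<^sup>V\<close> is a cardinal, i.e. that no \<open>\<alpha> < \<omega>\<^sub>2\<^sup>V\<close> is in bijection with it.
  (A universal quantifier over names commutes with the forcing relation.)
\<close>

definition preserves_omega2 :: "'p rel \<Rightarrow> bool" where
  "preserves_omega2 r \<longleftrightarrow>
     (\<forall>(\<alpha> :: omega2) (\<tau> :: (omega2 \<times> omega2, 'p) subset_name).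
        forced r (f_not r (f_bijection r {..<\<alpha>} UNIV \<tau>)))"

text \<open>
  ``The set \<open>{x. S x}\<close> of the extension is \<open>f\<close>-rainbow'', where \<open>S x\<close> is the statement
  that \<open>x\<close> is in the set. Finite subsets of \<open>\<omega>\<^sub>2\<close> in the extension are in the ground model, so the
  pairs of elements of the set are the \<open>a \<in> pairs UNIV\<close> all of whose elements satisfy \<open>S\<close>.
\<close>

definition f_rainbow ::
  "'p rel \<Rightarrow> (omega2 set \<Rightarrow> omega2) \<Rightarrow> (omega2 \<Rightarrow> 'p fstmt) \<Rightarrow> 'p fstmt" where
  "f_rainbow r f S = f_all (pairs UNIV) (\<lambda>a. f_all (pairs UNIV) (\<lambda>b.
     f_imp r (f_and (f_all a S) (f_and (f_all b S) (f_ground (f a = f b)))) (f_ground (a = b))))"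

text \<open>
  A name \<open>l\<close> is forced to be a total function \<open>\<omega>\<^sub>2 \<rightarrow> \<omega>\<^sub>1\<close> all of whose fibers are
  \<open>f\<close>-rainbow.
\<close>

definition adds_rainbow_partition :: "'p rel \<Rightarrow> (omega2 set \<Rightarrow> omega2) \<Rightarrow> bool" where
  "adds_rainbow_partition r f \<longleftrightarrow>
     (\<exists>l :: (omega2 \<times> omega1, 'p) subset_name.
        forced r (f_and (f_function r UNIV UNIV l)
          (f_all UNIV (\<lambda>i :: omega1. f_rainbow r f (\<lambda>x. f_mem r (x, i) l)))))"

end

theory Submission
  imports Defs
begin

text \<open>
  A condition consists of a countable piece \<open>p\<close> of the partition \<open>l\<close> and a countable set of promises
  restricting its future growth. Countable closure is immediate, and a new point can always be put
  into a new class. The issue is that \<open>\<omega>\<^sub>2\<close> is preserved: without promises, a density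
  argument can bound every class below \<open>\<omega>\<^sub>2\<close> and so collapse \<open>\<omega>\<^sub>2\<close>.

  A promise \<open>t\<close> has a height \<open>gam t\<close>, a function \<open>bnd t\<close> and a set \<open>low t\<close> of at most \<open>\<omega>\<^sub>1\<close> promises.
  Above \<open>gam t\<close>, two points of a class that do not both exist yet must be separated according to
  \<open>bnd t\<close>. Below \<open>gam t\<close>, only promises from \<open>low t\<close> may still be made: \<open>t\<close> behaves like an elementary
  submodel of size \<open>\<omega>\<^sub>1\<close> used as a side condition.

  Suppose that a value (below \<open>\<omega>\<^sub>2\<close>) to be decided could not be bounded. Then there are conditions
  \<open>q \<delta>\<close>, for \<open>\<delta> < \<omega>\<^sub>2\<close>, whose new part lies above \<open>\<delta>\<close> and which decide a value above \<open>\<delta>\<close>. For a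
  point \<open>b\<close> of \<open>q \<delta>\<close>, the points \<open>a'\<close> with \<open>f {a', b} = f {a, b}\<close> form a countable set, so their
  supremum below \<open>\<delta>\<close> is a regressive function of \<open>\<delta>\<close>. Player II's answers to these functions yield a
  bound \<open>g\<close>. A condition of the same kind whose new points are separated by \<open>g\<close> is compatible with
  \<open>q \<delta>\<close> for some larger \<open>\<delta>\<close>, although it decides a smaller value: a contradiction.
\<close>

section \<open>Sets of size at most \<open>\<omega>\<^sub>1\<close>\<close>

definition small :: "'a set \<Rightarrow> bool" where
  "small A \<longleftrightarrow> |A| \<le>o |UNIV :: omega1 set|"

lemma countable_iff_card_of_nat: "countable A \<longleftrightarrow> |A| \<le>o |UNIV :: nat set|"
  unfolding countable_def using card_of_ordLeq[of A "UNIV :: nat set"] by auto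

lemma card_omega1: "|UNIV :: omega1 set| =o cardSuc natLeq"
proof -
  have "bij_betw Rep_omega1 UNIV (Field (cardSuc natLeq))"
    by (metis bij_betw_def inj_on_def Rep_omega1_inject type_definition.Rep_range type_definition_omega1)
  then have "|UNIV :: omega1 set| =o |Field (cardSuc natLeq)|"
    using card_of_ordIsoI by blast
  also have "|Field (cardSuc natLeq)| =o cardSuc natLeq"
    by (simp add: card_of_Field_ordIso cardSuc_Card_order natLeq_Card_order)
  finally show ?thesis .
qed

lemma card_omega2: "|UNIV :: omega2 set| =o cardSuc |UNIV :: omega1 set|"
proof -
  have "bij_betw Rep_omega2 UNIV (Field (cardSuc (cardSuc natLeq)))"
    by (metis bij_betw_def inj_on_def Rep_omega2_inject type_definition.Rep_range type_definition_omega2)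
  then have "|UNIV :: omega2 set| =o |Field (cardSuc (cardSuc natLeq))|"
    using card_of_ordIsoI by blast
  also have "|Field (cardSuc (cardSuc natLeq))| =o cardSuc (cardSuc natLeq)"
    by (simp add: card_of_Field_ordIso cardSuc_Card_order natLeq_Card_order)
  also have "cardSuc (cardSuc natLeq) =o cardSuc |UNIV :: omega1 set|"
    using card_omega1 cardSuc_invar_ordIso card_of_Card_order cardSuc_Card_order natLeq_Card_order
      ordIso_symmetric by blast
  finally show ?thesis .
qed

lemma infinite_omega1: "infinite (UNIV :: omega1 set)"
proof -
  have "natLeq <o |UNIV :: omega1 set|"
    using cardSuc_greater[OF natLeq_Card_order] card_omega1 ordIso_symmetric ordLess_ordIso_trans by blast
  then show ?thesis
    using infinite_iff_natLeq_ordLeq ordLess_imp_ordLeq by blast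
qed

lemma uncountable_omega1: "uncountable (UNIV :: omega1 set)"
proof
  assume "countable (UNIV :: omega1 set)"
  then have "|UNIV :: omega1 set| \<le>o |UNIV :: nat set|"
    by (simp add: countable_iff_card_of_nat)
  then have "|UNIV :: omega1 set| \<le>o natLeq"
    using card_of_nat ordLeq_ordIso_trans by blast
  then have "cardSuc natLeq \<le>o natLeq"
    using card_omega1 ordIso_ordLeq_trans ordIso_symmetric by blast
  then show False
    using cardSuc_greater[OF natLeq_Card_order] not_ordLess_ordLeq by blast
qed

lemma small_mono: "small B \<Longrightarrow> A \<subseteq> B \<Longrightarrow> small A"
  unfolding small_def using card_of_mono1 ordLeq_transitive by blast

lemma small_image: "small A \<Longrightarrow> small (g ` A)"
  unfolding small_def using card_of_image ordLeq_transitive by blast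

lemma small_UN: "small A \<Longrightarrow> (\<And>x. x \<in> A \<Longrightarrow> small (B x)) \<Longrightarrow> small (\<Union>x\<in>A. B x)"
  unfolding small_def using card_of_UNION_ordLeq_infinite[OF infinite_omega1] by blast

lemma small_omega1: "small (A :: omega1 set)"
  unfolding small_def by (simp add: card_of_mono1)

lemma small_countable: "countable A \<Longrightarrow> small A"
proof -
  assume "countable A"
  then have "|A| \<le>o |UNIV :: nat set|"
    by (simp add: countable_iff_card_of_nat)
  also have "|UNIV :: nat set| \<le>o |UNIV :: omega1 set|"
    using infinite_omega1 infinite_iff_card_of_nat by blast
  finally show ?thesis
    unfolding small_def .
qed

lemma small_Un: "small A \<Longrightarrow> small B \<Longrightarrow> small (A \<union> B)"
  using small_UN[of "{True, False}" "\<lambda>b. if b then A else B"] small_countable[of "{True, False}"]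
  by (simp add: Un_commute)

lemma small_insert: "small A \<Longrightarrow> small (insert x A)"
  using small_Un[of "{x}" A] small_countable[of "{x}"] by simp

lemma small_Times: "small A \<Longrightarrow> small B \<Longrightarrow> small (A \<times> B)"
proof -
  assume "small A" "small B"
  moreover have "A \<times> B = (\<Union>x\<in>A. Pair x ` B)"
    by auto
  ultimately show ?thesis
    by (simp add: small_UN small_image)
qed

lemma small_imp_surj:
  assumes "small A" "A \<noteq> {}"
  obtains g :: "omega1 \<Rightarrow> 'a" where "range g = A"
  using assms card_of_ordLeq2[of A "UNIV :: omega1 set"] unfolding small_def by blast

lemma small_lessThan_omega2: "small {..<x :: omega2}"
proof -
  let ?r = "cardSuc (cardSuc natLeq)"
  have C: "Card_order ?r"
    by (simp add: cardSuc_Card_order natLeq_Card_order)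
  have "Rep_omega2 ` {..<x} \<subseteq> underS ?r (Rep_omega2 x)"
    by (auto simp: underS_def less_omega2_def less_eq_omega2_def Rep_omega2_inject)
  moreover have "inj_on Rep_omega2 {..<x}"
    by (simp add: inj_on_def Rep_omega2_inject)
  ultimately have "|{..<x}| \<le>o |underS ?r (Rep_omega2 x)|"
    using card_of_ordLeq by blast
  also have "|underS ?r (Rep_omega2 x)| <o ?r"
    by (rule card_of_underS[OF C Rep_omega2])
  finally have "|{..<x}| <o ?r" .
  then have "|{..<x}| \<le>o cardSuc natLeq"
    by (simp add: cardSuc_ordLeq_ordLess cardSuc_Card_order natLeq_Card_order card_of_Card_order)
  then show ?thesis
    unfolding small_def using card_omega1 ordIso_symmetric ordLeq_ordIso_trans by blast
qed

lemma small_atMost_omega2: "small {..x :: omega2}"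
  using small_insert[OF small_lessThan_omega2[of x], of x] by (rule small_mono) auto

lemma not_small_omega2: "\<not> small (UNIV :: omega2 set)"
proof
  assume "small (UNIV :: omega2 set)"
  then have "cardSuc |UNIV :: omega1 set| \<le>o |UNIV :: omega1 set|"
    unfolding small_def using card_omega2 ordIso_ordLeq_trans ordIso_symmetric by blast
  then show False
    using cardSuc_greater[OF card_of_Card_order] not_ordLess_ordLeq by blast
qed

lemma small_iff_less: "small A \<longleftrightarrow> |A| <o |UNIV :: omega2 set|"
proof -
  have "|A| <o |UNIV :: omega2 set| \<longleftrightarrow> |A| <o cardSuc |UNIV :: omega1 set|"
    using ordLess_ordIso_trans[OF _ card_omega2] ordLess_ordIso_trans[OF _ ordIso_symmetric[OF card_omega2]]
    by blast
  then show ?thesis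
    unfolding small_def by (simp add: cardSuc_ordLeq_ordLess card_of_Card_order)
qed

text \<open>Regularity of \<open>\<omega>\<^sub>2\<close>: the initial segments given by the points
  of \<open>A\<close> have a small union, and any point outside that union is a strict
  bound.\<close>

lemma small_bounded:
  assumes "small (A :: omega2 set)"
  obtains b where "\<forall>x\<in>A. x < b"
proof -
  have "small (\<Union>x\<in>A. {..x})"
    by (rule small_UN[OF assms small_atMost_omega2])
  then obtain b where "b \<notin> (\<Union>x\<in>A. {..x})"
    using not_small_omega2 by (metis UNIV_eq_I)
  then have "\<forall>x\<in>A. x < b"
    by (auto simp: not_le)
  then show ?thesis
    by (rule that)
qed

lemma countable_lessThan_omega1: "countable {..<x :: omega1}"
proof -
  let ?r = "cardSuc natLeq"
  have C: "Card_order ?r"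
    by (simp add: cardSuc_Card_order natLeq_Card_order)
  have "Rep_omega1 ` {..<x} \<subseteq> underS ?r (Rep_omega1 x)"
    by (auto simp: underS_def less_omega1_def less_eq_omega1_def Rep_omega1_inject)
  moreover have "inj_on Rep_omega1 {..<x}"
    by (simp add: inj_on_def Rep_omega1_inject)
  ultimately have "|{..<x}| \<le>o |underS ?r (Rep_omega1 x)|"
    using card_of_ordLeq by blast
  also have "|underS ?r (Rep_omega1 x)| <o ?r"
    by (rule card_of_underS[OF C Rep_omega1])
  finally have "|{..<x}| <o ?r" .
  then have "|{..<x}| \<le>o natLeq"
    by (simp add: cardSuc_ordLeq_ordLess natLeq_Card_order card_of_Card_order)
  then have "|{..<x}| \<le>o |UNIV :: nat set|"
    using card_of_nat ordIso_symmetric ordLeq_ordIso_trans by blast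
  then show ?thesis
    by (simp add: countable_iff_card_of_nat)
qed

lemma countable_bounded:
  assumes "countable (A :: omega1 set)"
  obtains b where "\<forall>x\<in>A. x < b"
proof -
  have "countable {..x :: omega1}" for x
    using countable_insert[OF countable_lessThan_omega1[of x], of x] by (rule countable_subset[rotated]) auto
  then have "countable (\<Union>x\<in>A. {..x})"
    using assms by blast
  then obtain b where "b \<notin> (\<Union>x\<in>A. {..x})"
    using uncountable_omega1 by (metis UNIV_eq_I)
  then have "\<forall>x\<in>A. x < b"
    by (auto simp: not_le)
  then show ?thesis
    by (rule that)
qed

section \<open>Countable subsets and closures under CH\<close>

text \<open>A sequence in \<open>\<omega>\<^sub>1\<close> is coded by one set of naturals, the
  \<open>prod_encode\<close> sum of the sets that \<open>j\<close> attaches to its terms, so CH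
  leaves only \<open>\<omega>\<^sub>1\<close> many sequences. Every nonempty countable subset of
  \<open>A\<close> is the \<open>g\<close>-image of the range of such a sequence.\<close>

lemma small_countable_subsets:
  assumes "CH" "small A"
  shows "small {e. e \<subseteq> A \<and> countable e}"
proof (cases "A = {}")
  case False
  obtain g :: "omega1 \<Rightarrow> 'a" where g: "range g = A"
    using small_imp_surj assms(2) False by blast
  have eq: "|UNIV :: nat set set| =o |UNIV :: omega1 set|"
    using assms(1) card_omega1 ordIso_symmetric ordIso_transitive unfolding CH_def by blast
  then obtain j :: "omega1 \<Rightarrow> nat set" where j: "inj j"
    using card_of_ordIso[of "UNIV :: nat set set" "UNIV :: omega1 set"] 
    by (metis bij_betw_def bij_betw_inv)
  have "inj (\<lambda>u :: nat \<Rightarrow> omega1. {prod_encode (n, k) |n k. k \<in> j (u n)})"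
  proof (rule injI, rule ext)
    fix u v :: "nat \<Rightarrow> omega1" and n
    assume E: "{prod_encode (n, k) |n k. k \<in> j (u n)} = {prod_encode (n, k) |n k. k \<in> j (v n)}"
    have mem: "prod_encode (n, k) \<in> {prod_encode (n, k) |n k. k \<in> j (w n)} \<longleftrightarrow> k \<in> j (w n)"
      for k and w :: "nat \<Rightarrow> omega1"
      by (auto dest: injD[OF inj_prod_encode])
    have "j (u n) = j (v n)"
      using mem[of _ u] mem[of _ v] E by (intro set_eqI) simp
    then show "u n = v n"
      using j by (simp add: injD)
  qed
  then have "|UNIV :: (nat \<Rightarrow> omega1) set| \<le>o |UNIV :: nat set set|"
    using card_of_ordLeq by blast
  then have "small (UNIV :: (nat \<Rightarrow> omega1) set)"
    unfolding small_def using eq ordLeq_ordIso_trans by blast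
  then have "small (insert {} (range (\<lambda>u :: nat \<Rightarrow> omega1. g ` range u)))"
    by (intro small_insert small_image)
  moreover have "{e. e \<subseteq> A \<and> countable e} \<subseteq> insert {} (range (\<lambda>u :: nat \<Rightarrow> omega1. g ` range u))"
  proof
    fix e assume "e \<in> {e. e \<subseteq> A \<and> countable e}"
    then have e: "e \<subseteq> range g" "countable e"
      using g by auto
    show "e \<in> insert {} (range (\<lambda>u :: nat \<Rightarrow> omega1. g ` range u))"
    proof (cases "e = {}")
      case False
      define u where "u n = (SOME z. g z = from_nat_into e n)" for n
      have "g (u n) = from_nat_into e n" for n
        unfolding u_def by (rule someI_ex) (use from_nat_into[OF False, of n] e(1) in fastforce)
      then have "g ` range u = e"
        using range_from_nat_into[OF False e(2)] by (auto simp: image_image)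
      then show ?thesis
        by blast
    qed simp
  qed
  ultimately show ?thesis
    by (rule small_mono)
qed (simp add: small_countable countable_subset[of _ "{{}}"] subset_iff)

text \<open>The iteration along \<open>\<omega>\<^sub>1\<close> picks up every countable subset of its union, since \<open>\<omega>\<^sub>1\<close>
  has uncountable cofinality.\<close>

lemma small_closure:
  fixes G :: "'a set \<Rightarrow> 'a set"
  assumes "CH" "small Z" and G: "\<And>e. countable e \<Longrightarrow> small (G e)"
  obtains M where "Z \<subseteq> M" "small M" "\<And>e. e \<subseteq> M \<Longrightarrow> countable e \<Longrightarrow> G e \<subseteq> M"
proof -
  define step where "step rec \<nu> = Z \<union> (\<Union>\<mu>\<in>{..<\<nu>}. rec \<mu> \<union> (\<Union>e\<in>{e. e \<subseteq> rec \<mu> \<and> countable e}. G e))"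
    for rec and \<nu> :: omega1
  define N where "N = wfrec {(x, y :: omega1). x < y} step"
  have "adm_wf {(x, y :: omega1). x < y} step"
    unfolding adm_wf_def step_def by simp
  then have "N = step N"
    unfolding N_def by (intro wfrec_fixpoint wf)
  then have N: "N \<nu> = Z \<union> (\<Union>\<mu>\<in>{..<\<nu>}. N \<mu> \<union> (\<Union>e\<in>{e. e \<subseteq> N \<mu> \<and> countable e}. G e))" for \<nu>
    using step_def fun_cong by metis
  have smallN: "small (N \<nu>)" for \<nu>
  proof (induction \<nu> rule: less_induct)
    case (less \<nu>)
    show ?case
      unfolding N[of \<nu>]
      by (intro small_Un assms(2) small_UN small_omega1 small_countable_subsets assms(1) less G) auto
  qed
  have mono: "N \<mu> \<subseteq> N \<nu>" if "\<mu> \<le> \<nu>" for \<mu> \<nu>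
  proof (cases "\<mu> = \<nu>")
    case False
    then have "\<mu> \<in> {..<\<nu>}"
      using that by simp
    then show ?thesis
      unfolding N[of \<nu>] by blast
  qed simp
  show ?thesis
  proof
    show "Z \<subseteq> (\<Union>\<nu>. N \<nu>)"
      using N by blast
    show "small (\<Union>\<nu>. N \<nu>)"
      by (intro small_UN small_omega1 smallN)
    fix e assume e: "e \<subseteq> (\<Union>\<nu>. N \<nu>)" "countable e"
    define k where "k x = (LEAST \<nu>. x \<in> N \<nu>)" for x
    have k: "x \<in> N (k x)" if "x \<in> e" for x
    proof -
      have "\<exists>\<nu>. x \<in> N \<nu>"
        using that e(1) by auto
      then show ?thesis
        unfolding k_def by (rule LeastI_ex)
    qed
    obtain b where "\<forall>x\<in>k ` e. x < b"
      using countable_bounded[OF countable_image[OF e(2)]] .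
    then have "k x \<le> b" if "x \<in> e" for x
      using that by (simp add: less_imp_le)
    then have sub: "e \<subseteq> N b"
      using k mono by blast
    obtain c where "b < c"
      using countable_bounded[of "{b}"] by auto
    then have "G e \<subseteq> N c"
      unfolding N[of c] using sub e(2) by blast
    then show "G e \<subseteq> (\<Union>\<nu>. N \<nu>)"
      by blast
  qed
qed

text \<open>A countable set cofinal in \<open>\<delta>\<close> would contain a strictly increasing
  cofinal sequence of length \<open>\<omega>\<close>, putting \<open>\<delta>\<close> into
  \<open>E_omega\<close>. The bound is weak because \<open>\<delta>\<close> may be the successor of
  a member of \<open>K\<close>.\<close>

lemma not_E_omega_bounded:
  assumes "\<delta> \<notin> E_omega" "0 < \<delta>" "countable K" "\<forall>y\<in>K. y < \<delta>"
  obtains z where "z < \<delta>" "\<forall>y\<in>K. y \<le> z"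
proof (rule ccontr)
  assume "\<not> thesis"
  note * = that
  have ub: "\<exists>y\<in>K. z < y" if "z < \<delta>" for z
    using that \<open>\<not> thesis\<close> * not_le by metis
  then have ne: "K \<noteq> {}"
    using assms(2) by auto
  define k where "k = from_nat_into K"
  have k: "k n \<in> K" for n
    unfolding k_def using ne by (rule from_nat_into)
  \<comment> \<open>Each term lies above its predecessor and above the member of \<open>K\<close>
    enumerated at that stage; the first makes \<open>s\<close> increasing, the second makes it
    cofinal.\<close>
  define s where "s = rec_nat (k 0) (\<lambda>n x. SOME y. y \<in> K \<and> max x (k n) < y)"
  have s: "s n \<in> K \<and> max (s n) (k n) < s (Suc n)" for n
  proof (induction n)
    case 0
    have "max (k 0) (k 0) < \<delta>"
      using k assms(4) by simp
    from ub[OF this] have "max (k 0) (k 0) < (SOME y. y \<in> K \<and> max (k 0) (k 0) < y)"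
      by (metis (no_types, lifting) someI)
    then show ?case
      using k by (simp add: s_def)
  next
    case (Suc n)
    have "max (s n) (k n) < \<delta>"
      using k assms(4) Suc by simp
    from someI_ex[OF ub[OF this, unfolded Bex_def]]
    have 1: "s (Suc n) \<in> K"
      by (simp add: s_def)
    then have "max (s (Suc n)) (k (Suc n)) < \<delta>"
      using k assms(4) by simp
    from someI_ex[OF ub[OF this, unfolded Bex_def]]
    show ?case
      using 1 by (simp add: s_def)
  qed
  have "strict_mono s"
    unfolding strict_mono_Suc_iff using s by simp
  moreover have "\<forall>n. s n < \<delta>"
    using s assms(4) by blast
  moreover have "\<exists>n. \<zeta> < s n" if \<zeta>: "\<zeta> < \<delta>" for \<zeta>
  proof -
    obtain y where y: "y \<in> K" "\<zeta> < y"
      using ub[OF \<zeta>] by blast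
    then obtain n where "k n = y"
      using assms(3) from_nat_into_surj unfolding k_def by metis
    then have "\<zeta> < s (Suc n)"
      using s[of n] y by auto
    then show ?thesis
      by blast
  qed
  ultimately have "\<delta> \<in> E_omega"
    unfolding E_omega_def by blast
  then show False
    using assms(1) by blast
qed

section \<open>Bounds from the game\<close>

text \<open>For countable \<open>D\<close> this is the order type of
  \<open>D \<inter> {..<x}\<close>, that is, the round belonging to \<open>x\<close> when
  \<open>D\<close> is traversed in increasing order.\<close>

function rank_in :: "omega2 set \<Rightarrow> omega2 \<Rightarrow> omega1" where
  "rank_in D x = (LEAST \<beta>. \<forall>z\<in>rank_in D ` (D \<inter> {..<x}). z < \<beta>)"
  by auto
termination
  by (relation "inv_image {(x, y :: omega2). x < y} snd") (auto intro: wf)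

text \<open>The moves that \<open>\<sigma>\<close> dictates against \<open>F\<close>. The
  conditional is \<open>restrict (answers \<sigma> F) {..<\<beta>}\<close> written out, so that the
  recursive calls visibly concern earlier rounds.\<close>

function answers :: "strategy_II \<Rightarrow> (omega1 \<Rightarrow> omega2 \<Rightarrow> omega2) \<Rightarrow> omega1 \<Rightarrow> omega2" where
  "answers \<sigma> F \<beta> = \<sigma> \<beta> (restrict F {..\<beta>}) (\<lambda>\<gamma>. if \<gamma> \<in> {..<\<beta>} then answers \<sigma> F \<gamma> else undefined)"
  by auto
termination
  by (relation "inv_image {(x, y :: omega1). x < y} (snd \<circ> snd)") (auto intro: wf)

declare rank_in.simps [simp del] answers.simps [simp del]

lemma rank_in_less:
  assumes "countable D" "y \<in> D" "y < x"
  shows "rank_in D y < rank_in D x"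
proof -
  obtain b where "\<forall>z\<in>rank_in D ` (D \<inter> {..<x}). z < b"
    using countable_bounded[OF countable_image[OF countable_Int1[OF assms(1)]]] .
  from LeastI[of "\<lambda>\<beta>. \<forall>z\<in>rank_in D ` (D \<inter> {..<x}). z < \<beta>", OF this]
  show ?thesis
    using assms(2,3) unfolding rank_in.simps[of D x] by blast
qed

lemma rank_in_local: "x \<le> a \<Longrightarrow> rank_in (D \<inter> {..a}) x = rank_in D x"
proof (induction x rule: less_induct)
  case (less x)
  have "D \<inter> {..a} \<inter> {..<x} = D \<inter> {..<x}"
    using less.prems by auto
  moreover have "rank_in (D \<inter> {..a}) ` (D \<inter> {..<x}) = rank_in D ` (D \<inter> {..<x})"
    using less by (intro image_cong) auto
  ultimately show ?case
    by (simp add: rank_in.simps[of _ x])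
qed

lemma answers_cong: "(\<And>\<gamma>. \<gamma> \<le> \<beta> \<Longrightarrow> F \<gamma> = G \<gamma>) \<Longrightarrow> answers \<sigma> F \<beta> = answers \<sigma> G \<beta>"
proof (induction \<beta> rule: less_induct)
  case (less \<beta>)
  have "restrict F {..\<beta>} = restrict G {..\<beta>}"
    using less.prems by (intro restrict_ext) auto
  moreover have "(\<lambda>\<gamma>. if \<gamma> \<in> {..<\<beta>} then answers \<sigma> F \<gamma> else undefined) =
      (\<lambda>\<gamma>. if \<gamma> \<in> {..<\<beta>} then answers \<sigma> G \<gamma> else undefined)"
    using less by auto
  ultimately show ?case
    unfolding answers.simps[of _ _ \<beta>] by simp
qed

lemma follows_answers: "follows \<sigma> \<alpha> F (answers \<sigma> F)"
  unfolding follows_def by (subst answers.simps) (simp add: restrict_def)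

text \<open>Player I's run that plays \<open>\<phi> a\<close>, for \<open>a\<close> in the countable set \<open>D\<close>, in increasing order.\<close>

definition run_along :: "(omega2 \<Rightarrow> 'a) \<Rightarrow> omega2 set \<Rightarrow> omega1 \<Rightarrow> 'a" where
  "run_along \<phi> D \<beta> =
     (if \<exists>a\<in>D. rank_in D a = \<beta> then \<phi> (THE a. a \<in> D \<and> rank_in D a = \<beta>) else \<phi> 0)"

lemma run_along_rank:
  assumes "countable D" "a \<in> D"
  shows "run_along \<phi> D (rank_in D a) = \<phi> a"
proof -
  have "(THE x. x \<in> D \<and> rank_in D x = rank_in D a) = a"
    using assms rank_in_less by (intro the_equality) (auto, metis less_irrefl neqE)
  then show ?thesis
    using assms(2) by (auto simp: run_along_def)
qed

text \<open>Points of \<open>D\<close> above \<open>a\<close> have larger rank than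
  \<open>a\<close>, so no round up to that of \<open>a\<close> consults them. This makes II's answer
  to the move for \<open>a\<close> a function of \<open>D \<inter> {..a}\<close>.\<close>

lemma run_along_local:
  assumes "countable D" "a \<in> D" "\<beta> \<le> rank_in D a"
  shows "run_along \<phi> (D \<inter> {..a}) \<beta> = run_along \<phi> D \<beta>"
proof -
  have "x \<in> D \<and> rank_in D x = \<beta> \<longleftrightarrow> x \<in> D \<inter> {..a} \<and> rank_in (D \<inter> {..a}) x = \<beta>" for x
  proof (cases "x \<le> a")
    case False
    then have "rank_in D a < rank_in D x"
      using rank_in_less assms(1,2) by simp
    then show ?thesis
      using assms(3) False by auto
  qed (simp add: rank_in_local)
  then show ?thesis
    unfolding run_along_def Bex_def by presburger
qed

lemma small_in_ideal:
  assumes "ideal_on_omega2 I" "lt_omega2_complete I" "small A"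
  shows "A \<in> I"
proof -
  have "(\<lambda>x. {x}) ` A \<subseteq> I"
    using assms(1) unfolding ideal_on_omega2_def by auto
  moreover have "|(\<lambda>x. {x}) ` A| <o |UNIV :: omega2 set|"
    using small_image[OF assms(3)] small_iff_less by blast
  ultimately have "\<Union>((\<lambda>x. {x}) ` A) \<in> I"
    using assms(2) unfolding lt_omega2_complete_def by blast
  then show ?thesis
    by simp
qed

lemma exists_greater_omega2: "\<exists>y. x < (y :: omega2)"
  using small_bounded[of "{x}"] small_countable[of "{x}"] by auto

text \<open>The game hypothesis speaks of families of size exactly \<open>\<omega>\<^sub>2\<close>,
  while \<open>range \<phi>\<close> may be smaller. It is padded with the functions that are
  constantly \<open>c\<close> above \<open>c\<close> and 0 elsewhere.\<close>

lemma card_omega2_regressive: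
  fixes \<phi> :: "omega2 \<Rightarrow> omega2 \<Rightarrow> omega2"
  assumes "\<And>a. regressive (\<phi> a)"
  obtains \<X> where "range \<phi> \<subseteq> \<X>" "\<forall>g\<in>\<X>. regressive g" "|\<X>| =o |UNIV :: omega2 set|"
proof
  define g where "g c \<eta> = (if c < \<eta> then c else 0)" for c \<eta> :: omega2
  let ?X = "range \<phi> \<union> range g"
  have "inj g"
  proof (rule injI)
    fix c d assume "g c = g d"
    obtain \<eta> where "max c d < \<eta>"
      using exists_greater_omega2 by blast
    then show "c = d"
      using fun_cong[OF \<open>g c = g d\<close>, of \<eta>] by (simp add: g_def)
  qed
  show "\<forall>g\<in>?X. regressive g"
    using assms by (auto simp: regressive_def g_def)
  have inf: "infinite (UNIV :: omega2 set)"
    using not_small_omega2 small_countable countable_finite by blast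
  have "|?X| \<le>o |UNIV :: omega2 set|"
    by (rule card_of_Un_ordLeq_infinite_Field)
      (use inf in \<open>simp_all add: Field_card_of card_of_card_order_on card_of_image\<close>)
  moreover have "|UNIV :: omega2 set| \<le>o |?X|"
    using card_of_ordLeq[of "UNIV :: omega2 set" ?X] \<open>inj g\<close> by blast
  ultimately show "|?X| =o |UNIV :: omega2 set|"
    by (simp add: ordIso_iff_ordLeq)
qed simp

text \<open>The function \<open>g\<close> works for all
  lengths of the game and all countable sets \<open>D\<close> simultaneously, because II's answer to the move for
  \<open>a\<close> depends only on \<open>D \<inter> {..a}\<close>, for which there are only \<open>\<omega>\<^sub>1\<close> possibilities under CH.\<close>

lemma game_bound:
  fixes K :: "omega2 \<Rightarrow> omega2 \<Rightarrow> omega2 set"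
  assumes "CH"
    and game: "\<And>(\<X> :: (omega2 \<Rightarrow> omega2) set) (\<alpha> :: omega1).
           |\<X>| =o |UNIV :: omega2 set| \<Longrightarrow> (\<forall>g\<in>\<X>. regressive g) \<Longrightarrow>
           \<exists>I. ideal_on_omega2 I \<and> lt_omega2_complete I \<and> E_omega \<in> I \<and>
             II_has_winning_strategy \<alpha> I \<X>"
    and K: "\<And>a \<delta>. countable (K a \<delta>)" "\<And>a \<delta> y. y \<in> K a \<delta> \<Longrightarrow> y < \<delta>"
  obtains g where "\<And>D \<eta>. countable D \<Longrightarrow> \<exists>\<delta>>\<eta>. \<forall>a\<in>D. \<forall>y\<in>K a \<delta>. y < g a"
proof -
  \<comment> \<open>Off \<open>E_omega\<close> the countable set \<open>K a \<delta>\<close> is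
    bounded below \<open>\<delta>\<close>, so its least bound is a regressive choice. On
    \<open>E_omega\<close>, which belongs to the ideal, any value will do.\<close>
  define \<phi> where "\<phi> a \<delta> = (if \<delta> \<in> E_omega then 0 else LEAST z. \<forall>y\<in>K a \<delta>. y \<le> z)" for a \<delta>
  have zero: "0 \<le> (x :: omega2)" for x
    unfolding zero_omega2_def by (simp add: Least_le)
  have reg: "regressive (\<phi> a)" for a
    unfolding regressive_def
  proof (intro allI impI)
    fix \<delta> :: omega2 assume "0 < \<delta>"
    show "\<phi> a \<delta> < \<delta>"
    proof (cases "\<delta> \<in> E_omega")
      case False
      then obtain z where z: "z < \<delta>" "\<forall>y\<in>K a \<delta>. y \<le> z"
        using not_E_omega_bounded[OF _ \<open>0 < \<delta>\<close> K(1)[of a \<delta>]] K(2) by metis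
      then show ?thesis
        using False Least_le[of "\<lambda>z. \<forall>y\<in>K a \<delta>. y \<le> z" z] by (simp add: \<phi>_def)
    qed (simp add: \<phi>_def \<open>0 < \<delta>\<close>)
  qed
  have above: "y \<le> \<phi> a \<delta>" if "\<delta> \<notin> E_omega" "y \<in> K a \<delta>" for a \<delta> y
  proof -
    have "\<forall>y\<in>K a \<delta>. y \<le> \<delta>"
      using K(2) by (simp add: less_imp_le)
    from LeastI[of "\<lambda>z. \<forall>y\<in>K a \<delta>. y \<le> z", OF this] show ?thesis
      using that by (simp add: \<phi>_def)
  qed
  obtain \<X> where X: "range \<phi> \<subseteq> \<X>" "\<forall>g\<in>\<X>. regressive g" "|\<X>| =o |UNIV :: omega2 set|"
    using card_omega2_regressive[of \<phi>, OF reg] .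
  have "\<forall>\<alpha>. \<exists>I \<sigma>. ideal_on_omega2 I \<and> lt_omega2_complete I \<and> E_omega \<in> I \<and>
      (\<forall>F \<xi>. (\<forall>\<beta><\<alpha>. F \<beta> \<in> \<X>) \<and> follows \<sigma> \<alpha> F \<xi> \<longrightarrow> II_wins_run I \<alpha> F \<xi>)"
    using game[OF X(3,2)] unfolding II_has_winning_strategy_def by blast
  then obtain I \<sigma> where I: "\<And>\<alpha>. ideal_on_omega2 (I \<alpha>)" "\<And>\<alpha>. lt_omega2_complete (I \<alpha>)"
      "\<And>\<alpha>. E_omega \<in> I \<alpha>"
    and \<sigma>: "\<And>\<alpha> F \<xi>. (\<forall>\<beta><\<alpha>. F \<beta> \<in> \<X>) \<Longrightarrow> follows (\<sigma> \<alpha>) \<alpha> F \<xi> \<Longrightarrow> II_wins_run (I \<alpha>) \<alpha> F \<xi>"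
    by metis
  define ans where "ans a \<alpha> D = answers (\<sigma> \<alpha>) (run_along \<phi> D) (rank_in D a)" for a \<alpha> D
  have "\<exists>b. \<forall>\<alpha> e. e \<subseteq> {..a} \<longrightarrow> countable e \<longrightarrow> ans a \<alpha> e < b" for a
  proof -
    have "small (\<Union>\<alpha>. ans a \<alpha> ` {e. e \<subseteq> {..a} \<and> countable e})"
      by (intro small_UN small_omega1 small_image small_countable_subsets assms(1) small_atMost_omega2)
    then obtain b where "\<forall>x\<in>(\<Union>\<alpha>. ans a \<alpha> ` {e. e \<subseteq> {..a} \<and> countable e}). x < b"
      using small_bounded by blast
    then show ?thesis
      by blast
  qed
  then obtain g where g: "\<And>a \<alpha> e. e \<subseteq> {..a} \<Longrightarrow> countable e \<Longrightarrow> ans a \<alpha> e < g a"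
    by metis
  show ?thesis
  proof
    fix D :: "omega2 set" and \<eta> assume D: "countable D"
    obtain \<alpha> where \<alpha>: "\<forall>x\<in>rank_in D ` D. x < \<alpha>"
      using countable_bounded[OF countable_image[OF D]] .
    have "\<forall>\<beta><\<alpha>. run_along \<phi> D \<beta> \<in> \<X>"
      using X(1) by (auto simp: run_along_def)
    then have "II_wins_run (I \<alpha>) \<alpha> (run_along \<phi> D) (answers (\<sigma> \<alpha>) (run_along \<phi> D))"
      using \<sigma> follows_answers by blast
    then obtain Y where Y: "Y \<notin> I \<alpha>"
      and win: "\<And>\<delta> \<beta>. \<delta> \<in> Y \<Longrightarrow> \<beta> < \<alpha> \<Longrightarrow> run_along \<phi> D \<beta> \<delta> < answers (\<sigma> \<alpha>) (run_along \<phi> D) \<beta>"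
      unfolding II_wins_run_def by blast
    \<comment> \<open>A positive set is not covered by \<open>E_omega\<close> and an initial
      segment, so it has a member beyond \<open>\<eta>\<close> at which \<open>\<phi>\<close> really
      bounds \<open>K\<close>.\<close>
    have "{..\<eta>} \<in> I \<alpha>"
      by (rule small_in_ideal[OF I(1,2) small_atMost_omega2])
    then have "E_omega \<union> {..\<eta>} \<in> I \<alpha>"
      using I(1)[of \<alpha>] I(3)[of \<alpha>] unfolding ideal_on_omega2_def by blast
    then have "\<not> Y \<subseteq> E_omega \<union> {..\<eta>}"
      using I(1)[of \<alpha>] Y unfolding ideal_on_omega2_def by blast
    then obtain \<delta> where \<delta>: "\<delta> \<in> Y" "\<delta> \<notin> E_omega" "\<eta> < \<delta>"
      by (meson UnI1 UnI2 atMost_iff not_le subsetI)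
    have "y < g a" if "a \<in> D" "y \<in> K a \<delta>" for a y
    proof -
      have "y \<le> run_along \<phi> D (rank_in D a) \<delta>"
        using above[OF \<delta>(2) that(2)] run_along_rank[OF D that(1)] by metis
      also have "\<dots> < answers (\<sigma> \<alpha>) (run_along \<phi> D) (rank_in D a)"
        using win[OF \<delta>(1)] \<alpha> that(1) by simp
      also have "\<dots> = ans a \<alpha> (D \<inter> {..a})"
        unfolding ans_def rank_in_local[OF order.refl]
        by (rule answers_cong) (simp add: run_along_local[OF D that(1)])
      also have "\<dots> < g a"
        using g D by simp
      finally show ?thesis .
    qed
    then show "\<exists>\<delta>>\<eta>. \<forall>a\<in>D. \<forall>y\<in>K a \<delta>. y < g a"
      using \<delta>(3) by blast
  qed
qed

section \<open>The conditions\<close>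

text \<open>For normal \<open>f\<close>, pairs of equal colour share their maximum \<open>b\<close>,
  so every collision is between a point and one of its twins below a common
  \<open>b\<close>.\<close>

definition twins :: "(omega2 set \<Rightarrow> omega2) \<Rightarrow> omega2 \<Rightarrow> omega2 \<Rightarrow> omega2 set" where
  "twins f b a = {a'. a' < b \<and> f {a', b} = f {a, b}}"

lemma countable_twins:
  assumes "omega_bounded f"
  shows "countable (twins f b a)"
proof (rule countable_image_inj_on)
  show "inj_on (\<lambda>x. {x, b}) (twins f b a)"
    by (auto simp: inj_on_def twins_def doubleton_eq_iff)
  have "(\<lambda>x. {x, b}) ` twins f b a \<subseteq> {u \<in> pairs UNIV. f u = f {a, b}}"
    by (auto simp: twins_def pairs_def card_insert_if)
  then show "countable ((\<lambda>x. {x, b}) ` twins f b a)"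
    using assms countable_subset unfolding omega_bounded_def by blast
qed

text \<open>For normal \<open>f\<close> this expresses that all classes of \<open>p\<close> are
  rainbow; see \<open>rainbow_pairs\<close>.\<close>

definition no_twins :: "(omega2 set \<Rightarrow> omega2) \<Rightarrow> (omega2 \<times> omega1) set \<Rightarrow> bool" where
  "no_twins f p \<longleftrightarrow>
     (\<forall>a a' b i. (a, i) \<in> p \<longrightarrow> (a', i) \<in> p \<longrightarrow> (b, i) \<in> p \<longrightarrow> a < b \<longrightarrow> a' \<in> twins f b a \<longrightarrow> a' = a)"

definition twin_closed :: "(omega2 set \<Rightarrow> omega2) \<Rightarrow> omega2 set \<Rightarrow> bool" where
  "twin_closed f A \<longleftrightarrow> (\<forall>a\<in>A. \<forall>b\<in>A. a < b \<longrightarrow> twins f b a \<subseteq> A)"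

definition part :: "(omega2 set \<Rightarrow> omega2) \<Rightarrow> (omega2 \<times> omega1) set \<Rightarrow> bool" where
  "part f p \<longleftrightarrow> countable p \<and> single_valued p \<and> twin_closed f (Domain p) \<and> no_twins f p"

lemma part_empty: "part f {}"
  by (simp add: part_def single_valued_def twin_closed_def no_twins_def)

lemma part_single: "part f p \<Longrightarrow> (x, i) \<in> p \<Longrightarrow> (x, j) \<in> p \<Longrightarrow> i = j"
  unfolding part_def by (blast dest: single_valuedD)

lemma rainbow_pairs:
  assumes "normal_coloring f" "no_twins f p" "u \<in> pairs UNIV" "v \<in> pairs UNIV"
    and uv: "\<forall>x\<in>u \<union> v. (x, i) \<in> p" and eq: "f u = f v"
  shows "u = v"
proof -
  have ex: "\<exists>a b. w = {a, b} \<and> a < b \<and> Max w = b" if w: "w \<in> pairs UNIV" for w :: "omega2 set"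
  proof -
    obtain x y where "w = {x, y}" "x \<noteq> y"
      using w unfolding pairs_def card_2_iff by blast
    then show ?thesis
      by (intro exI[of _ "min x y"] exI[of _ "max x y"]) (auto simp: min_def max_def)
  qed
  obtain a b where u: "u = {a, b}" "a < b" "Max u = b"
    using ex assms(3) by blast
  obtain a' b' where v: "v = {a', b'}" "a' < b'" "Max v = b'"
    using ex assms(4) by blast
  have "b' = b"
    using assms(1,3,4) eq u(3) v(3) unfolding normal_coloring_def by metis
  then have "a' \<in> twins f b a"
    using u v eq by (simp add: twins_def)
  then have "a' = a"
    using assms(2) uv u v \<open>b' = b\<close> unfolding no_twins_def by blast
  then show ?thesis
    using u v \<open>b' = b\<close> by simp
qed

lemma twin_closure:
  assumes "omega_bounded f" "countable A"
  obtains B where "A \<subseteq> B" "countable B" "twin_closed f B"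
proof -
  define step where "step X = X \<union> (\<Union>a\<in>X. \<Union>b\<in>X. twins f b a)" for X
  define B where "B n = (step ^^ n) A" for n
  have cnt: "countable (B n)" for n
    unfolding B_def by (induction n) (auto simp: step_def assms countable_twins)
  have Suc: "B (Suc n) = step (B n)" for n
    by (simp add: B_def)
  have mono: "B m \<subseteq> B n" if "m \<le> n" for m n
    using that by (rule lift_Suc_mono_le[rotated]) (auto simp: Suc step_def)
  show ?thesis
  proof
    show "A \<subseteq> (\<Union>n. B n)"
      using UN_upper[of 0 UNIV B] by (simp add: B_def)
    show "countable (\<Union>n. B n)"
      using cnt by blast
    show "twin_closed f (\<Union>n. B n)"
      unfolding twin_closed_def
    proof (intro ballI impI)
      fix a b assume "a \<in> (\<Union>n. B n)" "b \<in> (\<Union>n. B n)"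
      then obtain m n where "a \<in> B m" "b \<in> B n"
        by blast
      then have "a \<in> B (max m n)" "b \<in> B (max m n)"
        using mono[of m "max m n"] mono[of n "max m n"] by auto
      then have "twins f b a \<subseteq> B (Suc (max m n))"
        unfolding Suc step_def by blast
      then show "twins f b a \<subseteq> (\<Union>n. B n)"
        by blast
    qed
  qed
qed

text \<open>Only countably many classes are in use, so each added point can receive a class of its
  own. As it shares its class with no other point, it can violate neither \<open>no_twins\<close>
  nor a promise.\<close>

lemma part_completion:
  assumes f: "omega_bounded f" and p: "countable p" "single_valued p" "no_twins f p"
    and A: "countable A"
  obtains p' where "part f p'" "p \<subseteq> p'" "A \<subseteq> Domain p'"
    "\<And>x y i. (x, i) \<in> p' \<Longrightarrow> (y, i) \<in> p' \<Longrightarrow> (x, i) \<notin> p \<Longrightarrow> y = x"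
proof -
  have dom: "countable (Domain p)" and ran: "countable (Range p)"
    using countable_image[OF p(1), of fst] countable_image[OF p(1), of snd]
    by (simp_all add: Domain_fst Range_snd)
  obtain B where B: "Domain p \<union> A \<subseteq> B" "countable B" "twin_closed f B"
    using twin_closure[OF f countable_Un[OF dom A]] .
  have "infinite (- Range p)"
  proof
    assume "finite (- Range p)"
    then have "countable (- Range p \<union> Range p)"
      by (rule countable_Un[OF countable_finite ran])
    moreover have "- Range p \<union> Range p = UNIV"
      by blast
    ultimately show False
      using uncountable_omega1 by metis
  qed
  then obtain h :: "nat \<Rightarrow> omega1" where h: "inj h" "range h \<subseteq> - Range p"
    using infinite_countable_subset by blast
  define c where "c x = h (to_nat_on B x)" for x
  have c: "c x \<notin> Range p" for x
    using h(2) by (auto simp: c_def)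
  have c_inj: "x = y" if "c x = c y" "x \<in> B" "y \<in> B" for x y
    using that h(1) inj_on_to_nat_on[OF B(2)] unfolding c_def by (auto dest: injD inj_onD)
  define p' where "p' = p \<union> (\<lambda>x. (x, c x)) ` (B - Domain p)"
  have dom': "Domain p' = B"
  proof -
    have "Domain ((\<lambda>x. (x, c x)) ` (B - Domain p)) = B - Domain p"
      by force
    then show ?thesis
      using B(1) unfolding p'_def Domain_Un_eq by blast
  qed
  have uniq: "y = x" if "(x, i) \<in> p'" "(y, i) \<in> p'" "(x, i) \<notin> p" for x y i
    using that c c_inj by (auto simp: p'_def)
  have "no_twins f p'"
    unfolding no_twins_def
  proof (intro allI impI)
    fix a a' b i
    assume 1: "(a, i) \<in> p'" "(a', i) \<in> p'" "(b, i) \<in> p'" "a < b" "a' \<in> twins f b a"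
    show "a' = a"
    proof (cases "(a, i) \<in> p \<and> (a', i) \<in> p \<and> (b, i) \<in> p")
      case True
      then show ?thesis
        using p(3) 1(4,5) unfolding no_twins_def by blast
    next
      case False
      then show ?thesis
        using uniq 1 by blast
    qed
  qed
  moreover have "single_valued p'"
    using p(2) unfolding p'_def single_valued_def by blast
  moreover have "countable p'"
    unfolding p'_def by (intro countable_Un p(1) countable_image countable_Diff B(2))
  ultimately have "part f p'"
    unfolding part_def using dom' B(3) by simp
  then show ?thesis
  proof (rule that)
    show "p \<subseteq> p'" "A \<subseteq> Domain p'"
      using B(1) unfolding dom' by (simp_all add: p'_def)
  qed (rule uniq)
qed

section \<open>Promises and the order of the conditions\<close>

type_synonym 't cond = "(omega2 \<times> omega1) set \<times> 't set"

text \<open>Since \<open>low t\<close> again consists of promises, their type is kept abstract: all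
  that matters is that every height, function and nonempty small set is realised by some promise.
  \<open>promise_coding\<close> supplies an instance.\<close>

locale promises =
  fixes gam :: "'t \<Rightarrow> omega2" and bnd :: "'t \<Rightarrow> omega2 \<Rightarrow> omega2" and low :: "'t \<Rightarrow> 't set"
    and f :: "omega2 set \<Rightarrow> omega2"
  assumes small_low: "small (low t)"
    and promise_exists: "small N \<Longrightarrow> N \<noteq> {} \<Longrightarrow> \<exists>t. gam t = \<gamma> \<and> bnd t = h \<and> low t = N"
    and bounded_f: "omega_bounded f"
    and CH: CH
begin

definition conds :: "'t cond set" where
  "conds = {(p, S). part f p \<and> countable S}"

text \<open>The last clause makes promises behave like nested submodels: one that is added after
  \<open>t\<close> either belongs to \<open>low t\<close> or swallows \<open>t\<close> together with
  \<open>low t\<close>.\<close>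

definition le :: "'t cond \<Rightarrow> 't cond \<Rightarrow> bool" (infix "\<preceq>" 50) where
  "r' \<preceq> r \<longleftrightarrow> fst r \<subseteq> fst r' \<and> snd r \<subseteq> snd r' \<and>
     (\<forall>t\<in>snd r. \<forall>a b i. (a, i) \<in> fst r' \<longrightarrow> (b, i) \<in> fst r' \<longrightarrow> a < b \<longrightarrow>
        (a, i) \<notin> fst r \<or> (b, i) \<notin> fst r \<longrightarrow> gam t \<le> a \<longrightarrow> bnd t a \<le> b) \<and>
     (\<forall>s\<in>snd r' - snd r. \<forall>t\<in>snd r. s \<in> low t \<or> gam t \<le> gam s \<and> insert t (low t) \<subseteq> low s)"

lemma leI:
  assumes "p \<subseteq> p'" "S \<subseteq> S'"
    and "\<And>t a b i. t \<in> S \<Longrightarrow> (a, i) \<in> p' \<Longrightarrow> (b, i) \<in> p' \<Longrightarrow> a < b \<Longrightarrow>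
       (a, i) \<notin> p \<or> (b, i) \<notin> p \<Longrightarrow> gam t \<le> a \<Longrightarrow> bnd t a \<le> b"
    and "\<And>s t. s \<in> S' \<Longrightarrow> s \<notin> S \<Longrightarrow> t \<in> S \<Longrightarrow>
       s \<in> low t \<or> gam t \<le> gam s \<and> insert t (low t) \<subseteq> low s"
  shows "(p', S') \<preceq> (p, S)"
  using assms unfolding le_def by auto

lemma leD:
  assumes "(p', S') \<preceq> (p, S)"
  shows "p \<subseteq> p'" "S \<subseteq> S'"
    and "\<And>t a b i. t \<in> S \<Longrightarrow> (a, i) \<in> p' \<Longrightarrow> (b, i) \<in> p' \<Longrightarrow> a < b \<Longrightarrow>
       (a, i) \<notin> p \<or> (b, i) \<notin> p \<Longrightarrow> gam t \<le> a \<Longrightarrow> bnd t a \<le> b"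
    and "\<And>s t. s \<in> S' \<Longrightarrow> s \<notin> S \<Longrightarrow> t \<in> S \<Longrightarrow>
       s \<in> low t \<or> gam t \<le> gam s \<and> insert t (low t) \<subseteq> low s"
  using assms unfolding le_def by auto

lemma le_refl: "r \<preceq> r"
  unfolding le_def by auto

lemma le_trans:
  assumes "r'' \<preceq> r'" "r' \<preceq> r"
  shows "r'' \<preceq> r"
proof -
  obtain p S p' S' p'' S'' where [simp]: "r = (p, S)" "r' = (p', S')" "r'' = (p'', S'')"
    by (metis surj_pair)
  note 1 = leD[OF assms(1)[simplified]] and 2 = leD[OF assms(2)[simplified]]
  have "(p'', S'') \<preceq> (p, S)"
  proof (rule leI)
    fix t a b i
    assume 3: "t \<in> S" "(a, i) \<in> p''" "(b, i) \<in> p''" "a < b" "(a, i) \<notin> p \<or> (b, i) \<notin> p" "gam t \<le> a"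
    show "bnd t a \<le> b"
    proof (cases "(a, i) \<in> p' \<and> (b, i) \<in> p'")
      case True
      then show ?thesis
        using 2(3) 3 by blast
    next
      case False
      then show ?thesis
        using 1(3) 2(2) 3 by blast
    qed
  next
    fix s t assume 3: "s \<in> S''" "s \<notin> S" "t \<in> S"
    show "s \<in> low t \<or> gam t \<le> gam s \<and> insert t (low t) \<subseteq> low s"
    proof (cases "s \<in> S'")
      case True
      then show ?thesis
        using 2(4) 3 by blast
    next
      case False
      then show ?thesis
        using 1(4) 2(2) 3 by blast
    qed
  qed (use 1(1,2) 2(1,2) in auto)
  then show ?thesis
    by simp
qed

lemma le_antisym: "r \<preceq> r' \<Longrightarrow> r' \<preceq> r \<Longrightarrow> r = r'"
  unfolding le_def by (auto intro: prod_eqI)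

lemma descending_le:
  assumes "\<And>n. s (Suc n) \<preceq> s n" "m \<le> n"
  shows "s n \<preceq> s m"
  using assms(2) by (induction n rule: dec_induct) (auto intro: le_refl le_trans assms(1))

lemma countably_closed_conds:
  assumes s: "\<And>n. s n \<in> conds" and dec: "\<And>n. s (Suc n) \<preceq> s n"
  shows "\<exists>q\<in>conds. \<forall>n. q \<preceq> s n"
proof -
  define P where "P n = fst (s n)" for n
  define S where "S n = snd (s n)" for n
  have c: "part f (P n)" "countable (S n)" for n
    using s[of n] by (auto simp: conds_def P_def S_def)
  have le: "(P n, S n) \<preceq> (P m, S m)" if "m \<le> n" for m n
    using descending_le[of s, OF dec that] by (simp add: P_def S_def)
  \<comment> \<open>Each clause on the union concerns at most three of its points at a time, and
    these already occur together at a common late stage.\<close>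
  have up: "\<exists>n. x \<in> P n \<and> y \<in> P n \<and> z \<in> P n \<and> m \<le> n"
    if xyz: "x \<in> (\<Union>n. P n)" "y \<in> (\<Union>n. P n)" "z \<in> (\<Union>n. P n)" for x y z m
  proof -
    obtain i j k where "x \<in> P i" "y \<in> P j" "z \<in> P k"
      using xyz by blast
    moreover define n where "n = max (max i j) (max k m)"
    have "i \<le> n" "j \<le> n" "k \<le> n" "m \<le> n"
      by (simp_all add: n_def le_max_iff_disj)
    ultimately have "x \<in> P n" "y \<in> P n" "z \<in> P n" "m \<le> n"
      using leD(1)[OF le[of i n]] leD(1)[OF le[of j n]] leD(1)[OF le[of k n]] by blast+
    then show ?thesis
      by blast
  qed
  have "part f (\<Union>n. P n)"
    unfolding part_def
  proof (intro conjI)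
    show "countable (\<Union>n. P n)"
      using c(1) unfolding part_def by blast
    show "single_valued (\<Union>n. P n)"
    proof (rule single_valuedI)
      fix x y z assume "(x, y) \<in> (\<Union>n. P n)" "(x, z) \<in> (\<Union>n. P n)"
      then obtain n where "(x, y) \<in> P n" "(x, z) \<in> P n"
        using up by blast
      then show "y = z"
        using part_single[OF c(1)] by blast
    qed
    show "twin_closed f (Domain (\<Union>n. P n))"
      unfolding twin_closed_def
    proof (intro ballI impI)
      fix a b assume "a \<in> Domain (\<Union>n. P n)" "b \<in> Domain (\<Union>n. P n)" "a < b"
      then obtain n where "a \<in> Domain (P n)" "b \<in> Domain (P n)"
        using up by blast
      then have "twins f b a \<subseteq> Domain (P n)"
        using c(1)[of n] \<open>a < b\<close> unfolding part_def twin_closed_def by blast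
      then show "twins f b a \<subseteq> Domain (\<Union>n. P n)"
        by blast
    qed
    show "no_twins f (\<Union>n. P n)"
      unfolding no_twins_def
    proof (intro allI impI)
      fix a a' b i
      assume "(a, i) \<in> (\<Union>n. P n)" "(a', i) \<in> (\<Union>n. P n)" "(b, i) \<in> (\<Union>n. P n)"
        and 1: "a < b" "a' \<in> twins f b a"
      then obtain n where "(a, i) \<in> P n" "(a', i) \<in> P n" "(b, i) \<in> P n"
        using up by blast
      then show "a' = a"
        using c(1)[of n] 1 unfolding part_def no_twins_def by blast
    qed
  qed
  then have "(\<Union>n. P n, \<Union>n. S n) \<in> conds"
    using c(2) by (auto simp: conds_def)
  moreover have "(\<Union>n. P n, \<Union>n. S n) \<preceq> (P m, S m)" for m
  proof (rule leI)
    fix t a b i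
    assume 1: "t \<in> S m" "(a, i) \<in> (\<Union>n. P n)" "(b, i) \<in> (\<Union>n. P n)" "a < b"
      "(a, i) \<notin> P m \<or> (b, i) \<notin> P m" "gam t \<le> a"
    then obtain n where "(a, i) \<in> P n" "(b, i) \<in> P n" "m \<le> n"
      using up by blast
    then show "bnd t a \<le> b"
      using leD(3)[OF le[OF \<open>m \<le> n\<close>]] 1 by blast
  next
    fix x t assume 1: "x \<in> (\<Union>n. S n)" "x \<notin> S m" "t \<in> S m"
    then obtain n where n: "x \<in> S n"
      by blast
    then have "m \<le> n"
      using leD(2)[OF le[of n m]] 1(2) by (meson in_mono linear)
    then show "x \<in> low t \<or> gam t \<le> gam x \<and> insert t (low t) \<subseteq> low x"
      using leD(4)[OF le[OF \<open>m \<le> n\<close>]] 1 n by blast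
  qed auto
  ultimately show ?thesis
    by (intro bexI[of _ "(\<Union>n. P n, \<Union>n. S n)"]) (simp_all add: P_def S_def)
qed

lemma dense_Domain:
  assumes "(p, S) \<in> conds"
  shows "\<exists>p'. (p', S) \<in> conds \<and> (p', S) \<preceq> (p, S) \<and> x \<in> Domain p'"
proof -
  have p: "countable p" "single_valued p" "no_twins f p" "countable S"
    using assms by (auto simp: conds_def part_def)
  obtain p' where p': "part f p'" "p \<subseteq> p'" "{x} \<subseteq> Domain p'"
    "\<And>x y i. (x, i) \<in> p' \<Longrightarrow> (y, i) \<in> p' \<Longrightarrow> (x, i) \<notin> p \<Longrightarrow> y = x"
    using part_completion[OF bounded_f p(1-3), of "{x}"] by (metis countable_empty countable_insert)
  have "(p', S) \<preceq> (p, S)"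
  proof (rule leI)
    fix a b i
    assume 1: "(a, i) \<in> p'" "(b, i) \<in> p'" "a < b" "(a, i) \<notin> p \<or> (b, i) \<notin> p"
    then have "a = b"
      using p'(4) by blast
    then show "bnd t a \<le> b" for t
      using 1(3) by simp
  qed (use p'(2) in auto)
  then show ?thesis
    using p' p(4) by (auto simp: conds_def)
qed

section \<open>Promises that behave like elementary submodels\<close>

text \<open>The fragment of elementarity that amalgamation uses: a pair lying across
  \<open>gam t\<close> automatically respects the promises in \<open>low t\<close>, and for pairs
  above \<open>gam t\<close> it suffices to respect \<open>t\<close> itself.\<close>

definition nice :: "'t \<Rightarrow> bool" where
  "nice t \<longleftrightarrow> (\<forall>u\<in>low t. low u \<subseteq> low t \<and> gam u \<le> gam t \<and>
     (\<forall>a<gam t. bnd u a \<le> gam t) \<and> (\<forall>a\<ge>gam t. bnd u a \<le> bnd t a))"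

text \<open>Promises (\<open>Inl\<close>) and ordinals (\<open>Inr\<close>) are closed off together
  by \<open>small_closure\<close>. The ordinals caught form an initial segment, whose length becomes
  \<open>gam t\<close>; the promises caught become \<open>low t\<close>. \<open>T\<close> is an
  arbitrary operation on countable data, for use in \<open>bounded_decision\<close>.\<close>

lemma nice_promise_exists:
  fixes T :: "(omega2 \<times> omega1) set \<Rightarrow> 't set \<Rightarrow> 'j \<Rightarrow> 't"
  assumes "small Z" "small J"
  obtains t where "nice t" "Z \<subseteq> low t" "\<gamma> < gam t" "\<And>a. h a \<le> bnd t a"
    "\<And>p S i. countable p \<Longrightarrow> Domain p \<subseteq> {..<gam t} \<Longrightarrow> countable S \<Longrightarrow> S \<subseteq> low t \<Longrightarrow> i \<in> J \<Longrightarrow>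
       T p S i \<in> low t"
proof -
  \<comment> \<open>The summands put in the \<open>low\<close> sets, the heights, the values of the
    functions, the predecessors of ordinals (which make the caught ordinals an initial segment) and
    the values of \<open>T\<close>.\<close>
  define G where "G e = Inl ` (\<Union>u\<in>Inl -` e. low u) \<union> Inr ` (gam ` (Inl -` e)) \<union>
      Inr ` (\<Union>u\<in>Inl -` e. bnd u ` (Inr -` e)) \<union> Inr ` (\<Union>x\<in>Inr -` e. {..x}) \<union>
      Inl ` (\<Union>p\<in>{p. p \<subseteq> (Inr -` e) \<times> UNIV \<and> countable p}.
        \<Union>S\<in>{S. S \<subseteq> Inl -` e \<and> countable S}. T p S ` J)"
    for e :: "('t + omega2) set"
  have smallG: "small (G e)" if "countable e" for e
  proof -
    have "countable (Inl -` e)" "countable (Inr -` e)"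
      by (rule countable_image_inj_on, rule countable_subset[OF _ that], auto)+
    then have "small (Inl -` e)" "small (Inr -` e)"
      by (simp_all add: small_countable)
    then show ?thesis
      unfolding G_def
      by (intro small_Un small_image[OF small_UN] small_image[OF small_image] small_UN small_image small_low
          small_atMost_omega2 small_countable_subsets[OF CH] small_Times small_omega1 assms(2)) assumption+
  qed
  \<comment> \<open>An arbitrary promise, included so that \<open>low t\<close> is nonempty as
    \<open>promise_exists\<close> demands.\<close>
  define t0 :: 't where "t0 = undefined"
  have Z: "small (Inl ` insert t0 Z \<union> {Inr \<gamma>} :: ('t + omega2) set)"
    by (intro small_Un small_image small_insert assms(1)) (simp add: small_countable)
  obtain M :: "('t + omega2) set" where M: "Inl ` insert t0 Z \<union> {Inr \<gamma>} \<subseteq> M" "small M"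
      "\<And>e. e \<subseteq> M \<Longrightarrow> countable e \<Longrightarrow> G e \<subseteq> M"
  proof (rule small_closure[OF CH Z])
    show "small (G e)" if "countable e" for e
      using that by (rule smallG)
  qed blast
  define U where "U = Inl -` M"
  define X where "X = Inr -` M"
  have "(case_sum id (\<lambda>_. t0)) ` M \<supseteq> U" "(case_sum (\<lambda>_. 0) id) ` M \<supseteq> X"
    by (force simp: U_def X_def)+
  then have smallU: "small U" and smallO: "small X"
    using small_mono[OF small_image[OF M(2)]] by blast+
  have down: "y \<in> X" if "x \<in> X" "y \<le> x" for x y
  proof -
    have "Inr y \<in> G {Inr x}"
      using that(2) by (auto simp: G_def)
    then show ?thesis
      using M(3)[of "{Inr x}"] that(1) by (auto simp: X_def)
  qed
  obtain z where z: "z \<notin> X"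
    using smallO not_small_omega2 by (metis UNIV_eq_I)
  define \<delta> where "\<delta> = (LEAST x. x \<notin> X)"
  have X: "X = {..<\<delta>}"
  proof (intro set_eqI iffI)
    fix x assume "x \<in> X"
    have "\<delta> \<notin> X"
      unfolding \<delta>_def using z by (rule LeastI)
    then show "x \<in> {..<\<delta>}"
      using down[OF \<open>x \<in> X\<close>, of \<delta>] by (metis lessThan_iff not_le)
  next
    fix x assume "x \<in> {..<\<delta>}"
    then show "x \<in> X"
      using not_less_Least[of x "\<lambda>x. x \<notin> X"] by (auto simp: \<delta>_def)
  qed
  \<comment> \<open>\<open>bnd t\<close> may be taken above all functions of \<open>low t\<close> at
    once, since at each \<open>a\<close> they have only \<open>\<omega>\<^sub>1\<close> many
    values.\<close>
  have "\<exists>b. h a \<le> b \<and> (\<forall>u\<in>U. bnd u a \<le> b)" for a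
  proof -
    have "small (insert (h a) ((\<lambda>u. bnd u a) ` U))"
      by (intro small_insert small_image smallU)
    then obtain b where "\<forall>x\<in>insert (h a) ((\<lambda>u. bnd u a) ` U). x < b"
      using small_bounded by blast
    then show ?thesis
      by (intro exI[of _ b]) (auto simp: less_imp_le)
  qed
  then obtain h' where h': "\<And>a. h a \<le> h' a" "\<And>a u. u \<in> U \<Longrightarrow> bnd u a \<le> h' a"
    by metis
  have "U \<noteq> {}"
    using M(1) by (auto simp: U_def)
  then obtain t where t: "gam t = \<delta>" "bnd t = h'" "low t = U"
    using promise_exists[OF smallU] by blast
  have 1: "low u \<subseteq> U" "gam u \<in> X" if "u \<in> U" for u
  proof -
    have "Inl ` low u \<subseteq> G {Inl u}" "Inr (gam u) \<in> G {Inl u}"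
      by (auto simp: G_def)
    then show "low u \<subseteq> U" "gam u \<in> X"
      using M(3)[of "{Inl u}"] that by (auto simp: U_def X_def)
  qed
  have 2: "bnd u a \<in> X" if "u \<in> U" "a \<in> X" for u a
  proof -
    have "Inr (bnd u a) \<in> G {Inl u, Inr a}"
      by (auto simp: G_def)
    then show ?thesis
      using M(3)[of "{Inl u, Inr a}"] that by (auto simp: U_def X_def)
  qed
  show ?thesis
  proof
    show "nice t"
      unfolding nice_def t using 1 2 h'(2) by (auto simp: X less_imp_le)
    show "Z \<subseteq> low t" "h a \<le> bnd t a" for a
      using M(1) h'(1) by (auto simp: t U_def)
    show "\<gamma> < gam t"
      using M(1) X by (auto simp: t X_def)
    fix p :: "(omega2 \<times> omega1) set" and S i
    assume p: "countable p" "Domain p \<subseteq> {..<gam t}" "countable S" "S \<subseteq> low t" "i \<in> J"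
    let ?e = "Inr ` Domain p \<union> Inl ` S :: ('t + omega2) set"
    have "countable (Domain p)"
      using countable_image[OF p(1), of fst] by (simp add: Domain_fst)
    then have e: "?e \<subseteq> M" "countable ?e"
      using p X by (auto simp: t U_def X_def)
    have 3: "p \<in> {p. p \<subseteq> (Inr -` ?e) \<times> UNIV \<and> countable p}" "S \<in> {S. S \<subseteq> Inl -` ?e \<and> countable S}"
      using p(1,3) by auto
    have "Inl (T p S i) \<in> G ?e"
      unfolding G_def by (intro UnI2 imageI, rule UN_I[OF 3(1)], rule UN_I[OF 3(2)]) (rule imageI[OF p(5)])
    then show "T p S i \<in> low t"
      using M(3)[OF e] by (auto simp: t U_def)
  qed
qed

end

section \<open>Bounding decided values\<close>

context promises begin

section \<open>Amalgamation across a nice promise\<close>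

lemma nice_promise_above:
  assumes "small Z"
  obtains t where "nice t" "Z \<subseteq> low t" "\<gamma> < gam t" "\<And>a. h a \<le> bnd t a"
proof (rule nice_promise_exists[OF assms small_omega1[of "{}"]])
  fix t assume "nice t" "Z \<subseteq> low t" "\<gamma> < gam t" "\<And>a. h a \<le> bnd t a"
  then show ?thesis
    by (rule that)
qed

lemma niceD:
  assumes "nice t" "u \<in> low t"
  shows "low u \<subseteq> low t" "gam u \<le> gam t" "a < gam t \<Longrightarrow> bnd u a \<le> gam t"
    "gam t \<le> a \<Longrightarrow> bnd u a \<le> bnd t a"
  using assms unfolding nice_def by auto

lemma add_promise_le:
  assumes "nice t" "S \<subseteq> low t"
  shows "(p, insert t S) \<preceq> (p, S)"
  using niceD(1,2)[OF assms(1)] assms(2) by (intro leI) auto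

text \<open>Closure of the domains under \<open>twins\<close> prevents a new point of the lower condition from
  clashing with two points of the upper one; two new points of the lower one are the case \<open>sep\<close>.\<close>

lemma amalgamate:
  assumes t: "nice t" "S \<subseteq> low t"
    and L: "(pl, Sl) \<in> conds" "(pl, Sl) \<preceq> (p, S)" "Domain pl \<subseteq> {..<gam t}" "Sl \<subseteq> low t"
    and H: "(ph, Sh) \<in> conds" "(ph, Sh) \<preceq> (p, insert t S)"
      "\<And>x j. (x, j) \<in> ph \<Longrightarrow> x < gam t \<Longrightarrow> (x, j) \<in> p" "Sh \<inter> low t \<subseteq> insert t S"
    and sep: "\<And>a a' b i. (a, i) \<in> pl - p \<Longrightarrow> (a', i) \<in> pl - p \<Longrightarrow> a < a' \<Longrightarrow> (b, i) \<in> ph \<Longrightarrow>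
      gam t \<le> b \<Longrightarrow> a' \<notin> twins f b a"
  obtains e where "e \<in> conds" "e \<preceq> (pl, Sl)" "e \<preceq> (ph, Sh)"
proof -
  have pl: "part f pl" "countable Sl" and ph: "part f ph" "countable Sh"
    using L(1) H(1) by (auto simp: conds_def)
  have ppl: "p \<subseteq> pl" and pph: "p \<subseteq> ph" and S: "S \<subseteq> Sl" "insert t S \<subseteq> Sh"
    using leD(1,2)[OF L(2)] leD(1,2)[OF H(2)] by auto
  have pl_low: "x < gam t" if "(x, j) \<in> pl" for x j
    using that L(3) by blast
  have ph_low: "(x, j) \<in> pl" if "(x, j) \<in> ph" "x < gam t" for x j
    using H(3)[OF that] ppl by blast
  have high: "gam t \<le> gam s \<and> insert t (low t) \<subseteq> low s" if "s \<in> Sh" "s \<notin> insert t S" for s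
    using leD(4)[OF H(2) that, of t] that H(4) by blast
  have nt: "no_twins f (pl \<union> ph)"
    unfolding no_twins_def
  proof (intro allI impI)
    fix a a' b i
    assume 1: "(a, i) \<in> pl \<union> ph" "(a', i) \<in> pl \<union> ph" "(b, i) \<in> pl \<union> ph" "a < b" "a' \<in> twins f b a"
    have 2: "a' < b" "a \<in> twins f b a'"
      using 1(4,5) by (auto simp: twins_def)
    show "a' = a"
    proof (cases "(b, i) \<in> pl")
      case True
      then have "(a, i) \<in> pl" "(a', i) \<in> pl"
        using 1 2 pl_low ph_low less_trans by blast+
      then show ?thesis
        using pl(1) True 1(4,5) unfolding part_def no_twins_def by blast
    next
      case False
      then have b: "(b, i) \<in> ph" "gam t \<le> b"
        using 1(3) ph_low not_le by blast+
      have mix: "(y, i) \<in> ph" if "(x, i) \<in> ph" "(y, i) \<in> pl" "x < b" "y \<in> twins f b x" for x y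
      proof -
        have "y \<in> Domain ph"
          using ph(1) that b unfolding part_def twin_closed_def by blast
        then obtain j where j: "(y, j) \<in> ph"
          by blast
        then have "(y, j) \<in> pl"
          using ph_low pl_low[OF that(2)] by blast
        then have "j = i"
          using part_single[OF pl(1)] that(2) by blast
        then show ?thesis
          using j by simp
      qed
      show ?thesis
      proof (cases "(a, i) \<in> ph \<or> (a', i) \<in> ph")
        case True
        then have "(a, i) \<in> ph \<and> (a', i) \<in> ph"
          using mix 1 2 by blast
        then show ?thesis
          using ph(1) b 1(4,5) unfolding part_def no_twins_def by blast
      next
        case False
        then have "(a, i) \<in> pl - p" "(a', i) \<in> pl - p"
          using 1 pph by auto
        then show ?thesis
          using sep b 1(5) 2(2) by (metis neqE)
      qed
    qed
  qed
  have sv: "single_valued (pl \<union> ph)"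
    using pl(1) ph(1) ph_low pl_low unfolding single_valued_def part_def by blast
  have cnt: "countable (pl \<union> ph)"
    using pl(1) ph(1) by (simp add: part_def)
  \<comment> \<open>The domain of the union need not be twin-closed. The points added to close it
    are alone in their classes, so every same-class pair of \<open>p'\<close> already lies in the
    union.\<close>
  obtain p' where p': "part f p'" "pl \<union> ph \<subseteq> p'" "{} \<subseteq> Domain p'"
    "\<And>x y i. (x, i) \<in> p' \<Longrightarrow> (y, i) \<in> p' \<Longrightarrow> (x, i) \<notin> pl \<union> ph \<Longrightarrow> y = x"
    by (rule part_completion[OF bounded_f cnt sv nt countable_empty]) blast
  have old: "(a, i) \<in> pl \<union> ph" "(b, i) \<in> pl \<union> ph" if "(a, i) \<in> p'" "(b, i) \<in> p'" "a < b" for a b i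
  proof -
    have "a \<noteq> b"
      using that(3) by simp
    then show "(a, i) \<in> pl \<union> ph" "(b, i) \<in> pl \<union> ph"
      using p'(4)[OF that(1,2)] p'(4)[OF that(2,1)] by blast+
  qed
  have "(p', Sl \<union> Sh) \<preceq> (pl, Sl)"
  proof (rule leI)
    fix u a b i
    assume 1: "u \<in> Sl" "(a, i) \<in> p'" "(b, i) \<in> p'" "a < b" "(a, i) \<notin> pl \<or> (b, i) \<notin> pl" "gam u \<le> a"
    note 2 = old[OF 1(2-4)]
    have b: "(b, i) \<notin> pl"
      using 1(4,5) 2 pl_low ph_low less_trans by blast
    then have b': "(b, i) \<in> ph" "gam t \<le> b"
      using 2 ph_low not_le by blast+
    have u: "u \<in> low t"
      using 1(1) L(4) by blast
    show "bnd u a \<le> b"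
    \<comment> \<open>A pair across \<open>gam t\<close> is separated since
      \<open>bnd u a \<le> gam t\<close>. A pair above \<open>gam t\<close> lies in
      \<open>ph\<close> and is new over \<open>p\<close>, so \<open>t\<close> separates it, and
      there \<open>bnd t\<close> dominates \<open>bnd u\<close>.\<close>
    proof (cases "a < gam t")
      case True
      then show ?thesis
        using niceD(3)[OF t(1) u] b'(2) by (meson order_trans)
    next
      case False
      then have a: "gam t \<le> a" "(a, i) \<notin> pl"
        using False pl_low by (simp add: not_less, blast)
      then have "bnd t a \<le> b"
        using leD(3)[OF H(2), of t a i b] 2 b' 1(4) ppl by auto
      moreover have "bnd u a \<le> bnd t a"
        using niceD(4)[OF t(1) u] False by simp
      ultimately show ?thesis
        by simp
    qed
  next
    fix s u assume 1: "s \<in> Sl \<union> Sh" "s \<notin> Sl" "u \<in> Sl"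
    have u: "u \<in> low t"
      using 1(3) L(4) by blast
    have "s = t \<or> gam t \<le> gam s \<and> insert t (low t) \<subseteq> low s"
      using high[of s] 1 S by blast
    then show "s \<in> low u \<or> gam u \<le> gam s \<and> insert u (low u) \<subseteq> low s"
      using niceD(1,2)[OF t(1) u] u by auto
  qed (use p'(2) in auto)
  moreover have "(p', Sl \<union> Sh) \<preceq> (ph, Sh)"
  proof (rule leI)
    fix u a b i
    assume 1: "u \<in> Sh" "(a, i) \<in> p'" "(b, i) \<in> p'" "a < b" "(a, i) \<notin> ph \<or> (b, i) \<notin> ph" "gam u \<le> a"
    note 2 = old[OF 1(2-4)]
    have a: "a < gam t"
      using 1(4,5) 2 pl_low less_trans by blast
    then have a': "(a, i) \<in> pl"
      using 2 ph_low by blast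
    \<comment> \<open>The height of \<open>u\<close> is at most \<open>a\<close>, hence below
      \<open>gam t\<close>, whereas the members of \<open>Sh\<close> outside \<open>S\<close> are
      \<open>t\<close> itself or promises at least as high as \<open>t\<close>.\<close>
    have u: "u \<in> S"
    proof (rule ccontr)
      assume "u \<notin> S"
      then have "gam t \<le> gam u"
        using high[OF 1(1)] by blast
      then show False
        using a 1(6) by simp
    qed
    show "bnd u a \<le> b"
    proof (cases "(b, i) \<in> pl")
      case True
      then show ?thesis
        using leD(3)[OF L(2) u a' True 1(4) _ 1(6)] 1(5) pph by blast
    next
      case False
      then have "gam t \<le> b"
        using 2 ph_low not_le by blast
      moreover have "bnd u a \<le> gam t"
        using niceD(3)[OF t(1) _ a] u t(2) by blast
      ultimately show ?thesis
        by simp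
    qed
  next
    fix s u assume 1: "s \<in> Sl \<union> Sh" "s \<notin> Sh" "u \<in> Sh"
    then have s: "s \<in> Sl" "s \<in> low t" "s \<notin> S"
      using L(4) S by auto
    show "s \<in> low u \<or> gam u \<le> gam s \<and> insert u (low u) \<subseteq> low s"
    proof (cases "u \<in> S")
      case True
      then show ?thesis
        using leD(4)[OF L(2) s(1,3)] by blast
    next
      case False
      then show ?thesis
        using high[OF 1(3)] s(2) by blast
    qed
  qed (use p'(2) in auto)
  moreover have "(p', Sl \<union> Sh) \<in> conds"
    using p'(1) pl(2) ph(2) by (simp add: conds_def)
  ultimately show ?thesis
    using that by blast
qed

lemma part_restrict:
  assumes "part f p"
  shows "part f {(x, j). (x, j) \<in> p \<and> x < \<gamma>}"
proof -
  let ?q = "{(x, j). (x, j) \<in> p \<and> x < \<gamma>}"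
  have "?q \<subseteq> p"
    by auto
  then have "countable ?q"
    using assms countable_subset unfolding part_def by blast
  moreover have "single_valued ?q"
    using assms unfolding part_def single_valued_def by blast
  moreover have "no_twins f ?q"
    using assms unfolding part_def no_twins_def by blast
  moreover have "twin_closed f (Domain ?q)"
    unfolding twin_closed_def
  proof (intro ballI impI subsetI)
    fix a b x assume 1: "a \<in> Domain ?q" "b \<in> Domain ?q" "a < b" "x \<in> twins f b a"
    then have "x \<in> Domain p"
      using assms unfolding part_def twin_closed_def by blast
    moreover have "x < \<gamma>"
      using 1 by (auto simp: twins_def)
    ultimately show "x \<in> Domain ?q"
      by blast
  qed
  ultimately show ?thesis
    unfolding part_def by blast
qed

lemma countable_Domain: "countable p \<Longrightarrow> countable (Domain p)"
  using countable_image[of p fst] by (simp add: Domain_fst)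

section \<open>Promises that bound decided values\<close>

text \<open>\<open>V i y r\<close> is to be read as: \<open>r\<close> decides the value at
  \<open>i\<close> to be \<open>y\<close>. The bad case is an extension of \<open>r0\<close> that
  adds nothing below \<open>t\<close> to \<open>(p, insert t S)\<close> and yet decides a value
  beyond \<open>gam t\<close>.\<close>

definition overshoots :: "('j \<Rightarrow> omega2 \<Rightarrow> 't cond \<Rightarrow> bool) \<Rightarrow> 't cond \<Rightarrow>
    (omega2 \<times> omega1) set \<Rightarrow> 't set \<Rightarrow> 'j \<Rightarrow> 't \<Rightarrow> bool" where
  "overshoots V r0 p S i t \<longleftrightarrow> (\<exists>p' S' y. (p', S') \<in> conds \<and> (p', S') \<preceq> r0 \<and>
     (p', S') \<preceq> (p, insert t S) \<and> (\<forall>x j. (x, j) \<in> p' \<longrightarrow> x < gam t \<longrightarrow> (x, j) \<in> p) \<and>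
     S' \<inter> low t \<subseteq> insert t S \<and> V i y (p', S') \<and> gam t < y)"

context
  fixes V :: "'j \<Rightarrow> omega2 \<Rightarrow> 't cond \<Rightarrow> bool" and r0 :: "'t cond"
  assumes game: "\<And>(\<X> :: (omega2 \<Rightarrow> omega2) set) (\<alpha> :: omega1).
           |\<X>| =o |UNIV :: omega2 set| \<Longrightarrow> (\<forall>g\<in>\<X>. regressive g) \<Longrightarrow>
           \<exists>I. ideal_on_omega2 I \<and> lt_omega2_complete I \<and> E_omega \<in> I \<and>
             II_has_winning_strategy \<alpha> I \<X>"
    and r0: "r0 \<in> conds"
    and V_mono: "\<And>i y r r'. V i y r \<Longrightarrow> r' \<in> conds \<Longrightarrow> r' \<preceq> r \<Longrightarrow> V i y r'"
    and V_fun: "\<And>i y z r. r \<in> conds \<Longrightarrow> r \<preceq> r0 \<Longrightarrow> V i y r \<Longrightarrow> V i z r \<Longrightarrow> y = z"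
begin

text \<open>The sets \<open>Sc p'\<close> of promises are chosen for all \<open>p'\<close> in advance, so that \<open>low (t \<delta>)\<close> can contain
  them before the game, and hence the condition to be amalgamated, is known.\<close>

lemma not_overshooting_exists:
  assumes R: "(p, S) \<in> conds"
  shows "\<exists>t. nice t \<and> S \<subseteq> low t \<and> Domain p \<subseteq> {..<gam t} \<and> \<not> overshoots V r0 p S i t"
proof (rule ccontr)
  assume *: "\<not> ?thesis"
  have p: "countable p" "countable S"
    using R by (auto simp: conds_def part_def)
  obtain \<eta> where \<eta>: "\<forall>x\<in>Domain p. x < \<eta>"
    using small_bounded[OF small_countable[OF countable_Domain[OF p(1)]]] .
  define D where "D = {p'. \<exists>S' y. (p', S') \<in> conds \<and> (p', S') \<preceq> (p, S) \<and> V i y (p', S')}"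
  have "\<forall>p'. \<exists>S' y. p' \<in> D \<longrightarrow> (p', S') \<in> conds \<and> (p', S') \<preceq> (p, S) \<and> V i y (p', S')"
    unfolding D_def by blast
  then obtain Sc yc where c: "\<And>p'. p' \<in> D \<Longrightarrow> (p', Sc p') \<in> conds"
      "\<And>p'. p' \<in> D \<Longrightarrow> (p', Sc p') \<preceq> (p, S)" "\<And>p'. p' \<in> D \<Longrightarrow> V i (yc p') (p', Sc p')"
    by metis
  have "\<exists>t q Sq y. nice t \<and> S \<subseteq> low t \<and> \<delta> < gam t \<and>
      (\<forall>p'\<in>D. Domain p' \<subseteq> {..<\<delta>} \<longrightarrow> Sc p' \<subseteq> low t) \<and>
      (q, Sq) \<in> conds \<and> (q, Sq) \<preceq> r0 \<and> (q, Sq) \<preceq> (p, insert t S) \<and>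
      (\<forall>x j. (x, j) \<in> q \<longrightarrow> x < gam t \<longrightarrow> (x, j) \<in> p) \<and>
      Sq \<inter> low t \<subseteq> insert t S \<and> V i y (q, Sq) \<and> gam t < y" for \<delta>
  proof -
    \<comment> \<open>By CH at most \<open>\<omega>\<^sub>1\<close> many countable parts live below
      \<open>\<delta>\<close>, so the promises chosen for all of them fit into one
      \<open>low t\<close>.\<close>
    let ?D = "{p'. p' \<subseteq> {..<\<delta>} \<times> UNIV \<and> countable p'} \<inter> D"
    have "small (Sc p')" if "p' \<in> D" for p'
      using c(1)[OF that] by (auto simp: conds_def intro: small_countable)
    moreover have "small ?D"
      by (rule small_mono[OF small_countable_subsets[OF CH]])
        (auto intro: small_Times small_lessThan_omega2 small_omega1)
    ultimately have Z: "small (S \<union> (\<Union>p'\<in>?D. Sc p'))"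
      by (intro small_Un small_UN small_countable[OF p(2)]) auto
    obtain t where t: "nice t" "S \<union> (\<Union>p'\<in>?D. Sc p') \<subseteq> low t" "max \<delta> \<eta> < gam t"
      by (rule nice_promise_above[OF Z, where \<gamma> = "max \<delta> \<eta>" and h = "\<lambda>_. 0"]) blast
    have "Domain p \<subseteq> {..<gam t}"
      using \<eta> t(3) by (meson lessThan_iff less_trans max_less_iff_conj subsetI)
    then have "overshoots V r0 p S i t"
      using * t(1,2) by blast
    moreover have "Sc p' \<subseteq> low t" if "p' \<in> D" "Domain p' \<subseteq> {..<\<delta>}" for p'
    proof -
      have "p' \<in> ?D"
        using that c(1)[OF that(1)] by (auto simp: conds_def part_def)
      then show ?thesis
        using t(2) by blast
    qed
    ultimately show ?thesis
      using t unfolding overshoots_def by (intro exI[of _ t]) auto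
  qed
  then obtain t q Sq y where t: "\<And>\<delta>. nice (t \<delta>)" "\<And>\<delta>. S \<subseteq> low (t \<delta>)" "\<And>\<delta>. \<delta> < gam (t \<delta>)"
      "\<And>\<delta> p'. p' \<in> D \<Longrightarrow> Domain p' \<subseteq> {..<\<delta>} \<Longrightarrow> Sc p' \<subseteq> low (t \<delta>)"
    and q: "\<And>\<delta>. (q \<delta>, Sq \<delta>) \<in> conds" "\<And>\<delta>. (q \<delta>, Sq \<delta>) \<preceq> r0"
      "\<And>\<delta>. (q \<delta>, Sq \<delta>) \<preceq> (p, insert (t \<delta>) S)"
      "\<And>\<delta> x j. (x, j) \<in> q \<delta> \<Longrightarrow> x < gam (t \<delta>) \<Longrightarrow> (x, j) \<in> p"
      "\<And>\<delta>. Sq \<delta> \<inter> low (t \<delta>) \<subseteq> insert (t \<delta>) S" "\<And>\<delta>. V i (y \<delta>) (q \<delta>, Sq \<delta>)"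
      "\<And>\<delta>. gam (t \<delta>) < y \<delta>"
    by metis
  \<comment> \<open>The points below \<open>\<delta>\<close> that could clash with \<open>a\<close>
    over some point of \<open>q \<delta>\<close>. The game supplies one \<open>g\<close> that bounds
    these sets for many \<open>\<delta>\<close>.\<close>
  define K where "K a \<delta> = (\<Union>b\<in>Domain (q \<delta>). twins f b a) \<inter> {..<\<delta>}" for a \<delta>
  have "countable (Domain (q \<delta>))" for \<delta>
    using q(1)[of \<delta>] by (intro countable_Domain) (simp add: conds_def part_def)
  then have K: "countable (K a \<delta>)" "x \<in> K a \<delta> \<Longrightarrow> x < \<delta>" for a \<delta> x
    using countable_twins[OF bounded_f] unfolding K_def by auto
  obtain g where g: "\<And>D \<eta>. countable D \<Longrightarrow> \<exists>\<delta>>\<eta>. \<forall>a\<in>D. \<forall>x\<in>K a \<delta>. x < g a"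
    by (rule game_bound[OF CH, of K]) (rule game K, assumption+, rule K, rule K, assumption, blast)
  \<comment> \<open>This promise overshoots too, by assumption; the new part \<open>p1\<close> of
    its witness must then have its same-class points separated by \<open>g\<close>.\<close>
  obtain t' where t': "nice t'" "S \<subseteq> low t'" "\<eta> < gam t'" "\<And>a. g a \<le> bnd t' a"
    by (rule nice_promise_above[OF small_countable[OF p(2)], where \<gamma> = \<eta> and h = g]) blast
  have "Domain p \<subseteq> {..<gam t'}"
    using \<eta> t'(3) by (meson lessThan_iff less_trans subsetI)
  then have "overshoots V r0 p S i t'"
    using * t' by blast
  then obtain p1 S1 y1 where p1: "(p1, S1) \<in> conds" "(p1, S1) \<preceq> (p, insert t' S)"
      "\<And>x j. (x, j) \<in> p1 \<Longrightarrow> x < gam t' \<Longrightarrow> (x, j) \<in> p" "V i y1 (p1, S1)"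
    unfolding overshoots_def by blast
  have "(p1, S1) \<preceq> (p, S)"
    using le_trans[OF p1(2) add_promise_le[OF t'(1,2)]] .
  then have "p1 \<in> D"
    using p1(1,4) unfolding D_def by blast
  have cnt: "countable (Domain p1)"
    using p1(1) by (intro countable_Domain) (simp add: conds_def part_def)
  obtain \<zeta> where \<zeta>: "\<forall>x\<in>insert (yc p1) (Domain p1). x < \<zeta>"
    using small_bounded[OF small_insert[OF small_countable[OF cnt]]] .
  obtain \<delta> where \<delta>: "\<zeta> < \<delta>" "\<forall>a\<in>Domain p1. \<forall>x\<in>K a \<delta>. x < g a"
    using g[OF cnt] by blast
  have dom: "Domain p1 \<subseteq> {..<\<delta>}"
    using \<zeta> \<delta>(1) by (meson insertI2 lessThan_iff less_trans subsetI)
  then have dom': "Domain p1 \<subseteq> {..<gam (t \<delta>)}"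
    using t(3)[of \<delta>] by (meson lessThan_iff less_trans subset_iff)
  have sep: "a' \<notin> twins f b a"
    if "(a, j) \<in> p1 - p" "(a', j) \<in> p1 - p" "a < a'" "(b, j) \<in> q \<delta>" for a a' b j
  proof
    assume "a' \<in> twins f b a"
    then have "a' \<in> K a \<delta>"
      using that dom unfolding K_def by blast
    then have "a' < g a"
      using \<delta>(2) that(1) by blast
    moreover have "gam t' \<le> a"
      using p1(3) that(1) by (auto simp: not_less[symmetric])
    then have "bnd t' a \<le> a'"
      using leD(3)[OF p1(2), of t' a j a'] that by blast
    ultimately show False
      using t'(4)[of a] by (meson le_less_trans less_le_trans less_irrefl)
  qed
  \<comment> \<open>The promises \<open>S1\<close> give way to \<open>Sc p1\<close>, which
    \<open>low (t \<delta>)\<close> contains by construction. The separation gained from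
    \<open>t'\<close> survives, being a property of \<open>p1\<close> and \<open>p\<close>
    alone.\<close>
  obtain e where e: "e \<in> conds" "e \<preceq> (p1, Sc p1)" "e \<preceq> (q \<delta>, Sq \<delta>)"
    by (rule amalgamate[OF t(1,2) c(1,2)[OF \<open>p1 \<in> D\<close>] dom' t(4)[OF \<open>p1 \<in> D\<close> dom] q(1,3,4,5)])
      (use sep in blast)+
  \<comment> \<open>The common extension \<open>e\<close> inherits both decisions and lies below
    \<open>r0\<close>, where decided values are unique; but
    \<open>yc p1 < \<zeta> < \<delta> < gam (t \<delta>) < y \<delta>\<close>.\<close>
  have "yc p1 = y \<delta>"
    using V_fun[OF e(1) le_trans[OF e(3) q(2)]] V_mono[OF c(3)[OF \<open>p1 \<in> D\<close>] e(1,2)]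
      V_mono[OF q(6) e(1,3)] by blast
  moreover have "yc p1 < y \<delta>"
    using \<zeta> \<delta>(1) t(3)[of \<delta>] q(7)[of \<delta>] by (meson insertI1 less_trans)
  ultimately show False
    by simp
qed

text \<open>A promise \<open>m\<close> closed under the choice \<open>T\<close> of non-overshooting
  promises is added. If \<open>r\<close> is below the result and \<open>(p, S)\<close> is its trace
  below \<open>m\<close>, then \<open>t = T p S i\<close> is in \<open>low m\<close> and can be
  added to \<open>r\<close>. A value above \<open>gam t\<close> would make \<open>t\<close>
  overshoot, so \<open>gam m\<close> bounds the values for all \<open>i \<in> J\<close> at
  once.\<close>

lemma bounded_decision:
  assumes J: "small J"
  obtains q \<gamma> where "q \<in> conds" "q \<preceq> r0"
    "\<And>r i y. r \<in> conds \<Longrightarrow> r \<preceq> q \<Longrightarrow> i \<in> J \<Longrightarrow> V i y r \<Longrightarrow> y \<le> \<gamma>"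
proof -
  obtain p0 S0 where r0_eq: "r0 = (p0, S0)"
    by (cases r0)
  have p0: "part f p0" "countable p0" "countable S0"
    using r0 by (auto simp: conds_def part_def r0_eq)
  obtain \<eta> where \<eta>: "\<forall>x\<in>Domain p0. x < \<eta>"
    using small_bounded[OF small_countable[OF countable_Domain[OF p0(2)]]] .
  define T where "T p S i =
      (SOME t. nice t \<and> S \<subseteq> low t \<and> Domain p \<subseteq> {..<gam t} \<and> \<not> overshoots V r0 p S i t)" for p S i
  have T: "nice (T p S i)" "S \<subseteq> low (T p S i)" "\<not> overshoots V r0 p S i (T p S i)"
    if "(p, S) \<in> conds" for p S i
    using someI_ex[OF not_overshooting_exists[OF that, of i]] unfolding T_def by blast+
  obtain m where m: "nice m" "S0 \<subseteq> low m" "\<eta> < gam m" "\<And>a. 0 \<le> bnd m a"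
    "\<And>p S i. countable p \<Longrightarrow> Domain p \<subseteq> {..<gam m} \<Longrightarrow> countable S \<Longrightarrow> S \<subseteq> low m \<Longrightarrow> i \<in> J \<Longrightarrow>
       T p S i \<in> low m"
    by (rule nice_promise_exists[OF small_countable[OF p0(3)] J, of \<eta> "\<lambda>_. 0" T]) blast
  have q: "(p0, insert m S0) \<in> conds" "(p0, insert m S0) \<preceq> r0"
    using p0 add_promise_le[OF m(1,2)] by (simp_all add: conds_def r0_eq)
  show ?thesis
  proof (rule that[OF q])
    fix r i y assume r: "r \<in> conds" "r \<preceq> (p0, insert m S0)" "i \<in> J" "V i y r"
    obtain pr Sr where r_eq: "r = (pr, Sr)"
      by (cases r)
    have pr: "part f pr" "countable pr" "countable Sr"
      using r(1) by (auto simp: conds_def part_def r_eq)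
    note le = leD[OF r(2)[unfolded r_eq]]
    define p where "p = {(x, j). (x, j) \<in> pr \<and> x < gam m}"
    define S where "S = Sr \<inter> low m"
    have R: "(p, S) \<in> conds"
      using part_restrict[OF pr(1)] pr(3) by (simp add: conds_def p_def S_def)
    have pS: "countable p" "Domain p \<subseteq> {..<gam m}" "countable S" "S \<subseteq> low m"
      using R by (auto simp: conds_def part_def p_def S_def)
    define t where "t = T p S i"
    have t: "nice t" "S \<subseteq> low t" "\<not> overshoots V r0 p S i t" "t \<in> low m"
      using T[OF R] m(5)[OF pS r(3)] by (simp_all add: t_def)
    have high: "insert m (low m) \<subseteq> low s \<and> gam m \<le> gam s" if "s \<in> Sr" "s \<notin> low m" "s \<noteq> m" for s
      using le(4)[OF that(1), of m] that m(2) by blast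
    \<comment> \<open>Promises of \<open>Sr\<close> inside \<open>low m\<close> belong to
      \<open>S\<close>, hence to \<open>low t\<close>; all others are \<open>m\<close> or contain
      \<open>low m\<close>, and so have \<open>t\<close> in their \<open>low\<close> set.\<close>
    have 1: "(pr, insert t Sr) \<preceq> (pr, Sr)"
    proof (rule leI)
      fix s u assume "s \<in> insert t Sr" "s \<notin> Sr" and u: "u \<in> Sr"
      then have [simp]: "s = t"
        by simp
      show "s \<in> low u \<or> gam u \<le> gam s \<and> insert u (low u) \<subseteq> low s"
      proof (cases "u \<in> low m")
        case True
        then have "u \<in> low t"
          using t(2) u by (auto simp: S_def)
        then show ?thesis
          using niceD(1,2)[OF t(1)] by simp
      next
        case False
        then show ?thesis
          using high[OF u False] t(4) by auto
      qed
    qed auto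
    have 2: "(pr, insert t Sr) \<preceq> (p, insert t S)"
    proof (rule leI)
      fix u a b j
      assume 3: "u \<in> insert t S" "(a, j) \<in> pr" "(b, j) \<in> pr" "a < b" "(a, j) \<notin> p \<or> (b, j) \<notin> p"
      have u: "u \<in> low m"
        using 3(1) t(4) pS(4) by blast
      have b: "gam m \<le> b"
        using 3(2-5) by (auto simp: p_def not_less[symmetric] dest: less_trans)
      show "bnd u a \<le> b"
      proof (cases "a < gam m")
        case True
        then show ?thesis
          using niceD(3)[OF m(1) u True] b by simp
      next
        case False
        \<comment> \<open>\<open>Domain p0\<close> lies below \<open>gam m\<close>, so the pair is
          new over \<open>p0\<close> and \<open>m\<close> binds it.\<close>
        then have "(a, j) \<notin> p0"
          using \<eta> m(3) by (meson DomainI less_trans)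
        then have "bnd m a \<le> b"
          using le(3)[of m a j b] 3 False by simp
        moreover have "bnd u a \<le> bnd m a"
          using niceD(4)[OF m(1) u] False by simp
        ultimately show ?thesis
          by simp
      qed
    next
      fix s u assume 3: "s \<in> insert t Sr" "s \<notin> insert t S" "u \<in> insert t S"
      have u: "u \<in> low m"
        using 3(3) t(4) pS(4) by blast
      have "s \<in> Sr" "s \<notin> low m"
        using 3(1,2) by (auto simp: S_def)
      then have "s = m \<or> insert m (low m) \<subseteq> low s \<and> gam m \<le> gam s"
        using high by blast
      then show "s \<in> low u \<or> gam u \<le> gam s \<and> insert u (low u) \<subseteq> low s"
        using niceD(1,2)[OF m(1) u] u by auto
    qed (auto simp: p_def S_def)
    have 3: "(pr, insert t Sr) \<in> conds" "(pr, insert t Sr) \<preceq> r0"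
      using pr le_trans[OF 1 le_trans[OF r(2)[unfolded r_eq] q(2)]] by (simp_all add: conds_def)
    have 4: "(x, j) \<in> p" if "(x, j) \<in> pr" "x < gam t" for x j
      using that niceD(2)[OF m(1) t(4)] by (simp add: p_def)
    have 5: "insert t Sr \<inter> low t \<subseteq> insert t S"
      using niceD(1)[OF m(1) t(4)] by (auto simp: S_def)
    have "V i y (pr, insert t Sr)"
      using V_mono[OF r(4) 3(1)] 1 by (simp add: r_eq)
    then have "\<not> gam t < y"
      using t(3) 2 3 4 5 unfolding overshoots_def by blast
    then show "y \<le> gam m"
      using niceD(2)[OF m(1) t(4)] by simp
  qed
qed

end

end

section \<open>The forcing relation\<close>

lemma infinite_omega2: "infinite (UNIV :: omega2 set)"
  using not_small_omega2 small_countable countable_finite by blast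

section \<open>Coding of promises and conditions\<close>

lemma card_Plus_le_omega2:
  assumes "|UNIV :: 'a set| \<le>o |UNIV :: omega2 set|" "|UNIV :: 'b set| \<le>o |UNIV :: omega2 set|"
  shows "|UNIV :: ('a + 'b) set| \<le>o |UNIV :: omega2 set|"
proof -
  have "|(UNIV :: 'a set) <+> (UNIV :: 'b set)| \<le>o |UNIV :: omega2 set|"
    by (rule card_of_Plus_ordLeq_infinite_Field)
      (use assms infinite_omega2 in \<open>simp_all add: Field_card_of card_of_card_order_on\<close>)
  then show ?thesis
    by simp
qed

lemma card_Times_le_omega2:
  assumes "|UNIV :: 'a set| \<le>o |UNIV :: omega2 set|" "|UNIV :: 'b set| \<le>o |UNIV :: omega2 set|"
  shows "|UNIV :: ('a \<times> 'b) set| \<le>o |UNIV :: omega2 set|"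
proof -
  have "|(UNIV :: 'a set) \<times> (UNIV :: 'b set)| \<le>o |UNIV :: omega2 set|"
    by (rule card_of_Times_ordLeq_infinite_Field)
      (use assms infinite_omega2 in \<open>simp_all add: Field_card_of card_of_card_order_on\<close>)
  then show ?thesis
    by simp
qed

lemma omega1_le_omega2: "|UNIV :: omega1 set| \<le>o |UNIV :: omega2 set|"
  using small_omega1 small_iff_less ordLess_imp_ordLeq by blast

text \<open>A sequence of \<open>\<omega>\<^sub>1\<close> many subsets of
  \<open>\<omega>\<^sub>2\<close> can be packed into one such subset, together with a height and the
  graph of a function. Hence \<open>inv code\<close> decodes subsets onto all triples.
  \<open>N\<close> must be nonempty because it is listed as the range of a sequence.\<close>

lemma promise_coding:
  obtains gam :: "omega2 set \<Rightarrow> omega2" and bnd :: "omega2 set \<Rightarrow> omega2 \<Rightarrow> omega2"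
    and low :: "omega2 set \<Rightarrow> omega2 set set"
  where "\<And>t. small (low t)"
    "\<And>N \<gamma> h. small N \<Longrightarrow> N \<noteq> {} \<Longrightarrow> \<exists>t. gam t = \<gamma> \<and> bnd t = h \<and> low t = N"
proof -
  have "|UNIV :: (omega2 + omega2 \<times> omega2 + omega1 \<times> omega2) set| \<le>o |UNIV :: omega2 set|"
    by (intro card_Plus_le_omega2 card_Times_le_omega2 omega1_le_omega2 ordLeq_refl card_of_Card_order)
  then obtain j :: "omega2 + omega2 \<times> omega2 + omega1 \<times> omega2 \<Rightarrow> omega2" where j: "inj j"
    using card_of_ordLeq[of "UNIV :: (omega2 + omega2 \<times> omega2 + omega1 \<times> omega2) set"
        "UNIV :: omega2 set"] by blast
  define code :: "omega2 \<times> (omega2 \<Rightarrow> omega2) \<times> (omega1 \<Rightarrow> omega2 set) \<Rightarrow> omega2 set"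
    where "code = (\<lambda>(\<gamma>, h, F). j ` {z. z = Inl \<gamma> \<or> (\<exists>a. z = Inr (Inl (a, h a))) \<or>
      (\<exists>i y. z = Inr (Inr (i, y)) \<and> y \<in> F i)})"
  have "inj code"
  proof (rule injI)
    fix u v assume "code u = code v"
    obtain \<gamma> h F \<gamma>' h' F' where uv: "u = (\<gamma>, h, F)" "v = (\<gamma>', h', F')"
      by (metis surj_pair)
    have E: "{z. z = Inl \<gamma> \<or> (\<exists>a. z = Inr (Inl (a, h a))) \<or> (\<exists>i y. z = Inr (Inr (i, y)) \<and> y \<in> F i)} =
        {z. z = Inl \<gamma>' \<or> (\<exists>a. z = Inr (Inl (a, h' a))) \<or> (\<exists>i y. z = Inr (Inr (i, y)) \<and> y \<in> F' i)}"
      (is "?A = ?B")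
    proof -
      have "j ` ?A = j ` ?B"
        using \<open>code u = code v\<close> unfolding code_def uv by simp
      then show ?thesis
        by (simp only: inj_image_eq_iff[OF j])
    qed
    have "Inl \<gamma> \<in> ?B"
      unfolding E[symmetric] by simp
    then have "\<gamma> = \<gamma>'"
      by simp
    moreover have "h a = h' a" for a
    proof -
      have "Inr (Inl (a, h a)) \<in> ?B"
        unfolding E[symmetric] by simp
      then show ?thesis
        by simp
    qed
    moreover have "F i = F' i" for i
    proof (rule set_eqI)
      fix y
      have "y \<in> F i \<longleftrightarrow> Inr (Inr (i, y)) \<in> ?A"
        by simp
      also have "\<dots> \<longleftrightarrow> y \<in> F' i"
        unfolding E by simp
      finally show "y \<in> F i \<longleftrightarrow> y \<in> F' i" .
    qed
    ultimately show "u = v"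
      unfolding uv by auto
  qed
  show ?thesis
  proof
    show "small (range (snd (snd (inv code t))))" for t
      by (intro small_image small_omega1)
    fix N :: "omega2 set set" and \<gamma> h assume "small N" "N \<noteq> {}"
    then obtain F :: "omega1 \<Rightarrow> omega2 set" where "range F = N"
      using small_imp_surj by blast
    then show "\<exists>t. fst (inv code t) = \<gamma> \<and> fst (snd (inv code t)) = h \<and> range (snd (snd (inv code t))) = N"
      using inv_f_f[OF \<open>inj code\<close>, of "(\<gamma>, h, F)"] by (intro exI[of _ "code (\<gamma>, h, F)"]) simp
  qed
qed

text \<open>Conditions are moved to the type on which the poset of the theorem lives. Promises turn
  into sets of \<open>Inl\<close> codes and points of the partition into singletons of
  \<open>Inr\<close> codes, so the two kinds cannot be confused.\<close>

lemma cond_coding: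
  obtains e :: "(omega2 \<times> omega1) set \<times> omega2 set set \<Rightarrow> omega2 set set" where "inj e"
proof -
  have "|UNIV :: (omega2 + omega2 \<times> omega1) set| \<le>o |UNIV :: omega2 set|"
    by (intro card_Plus_le_omega2 card_Times_le_omega2 omega1_le_omega2 ordLeq_refl card_of_Card_order)
  then obtain j :: "omega2 + omega2 \<times> omega1 \<Rightarrow> omega2" where j: "inj j"
    using card_of_ordLeq[of "UNIV :: (omega2 + omega2 \<times> omega1) set" "UNIV :: omega2 set"] by blast
  define e :: "(omega2 \<times> omega1) set \<times> omega2 set set \<Rightarrow> omega2 set set"
    where "e c = (\<lambda>X. j ` Inl ` X) ` snd c \<union> (\<lambda>x. {j (Inr x)}) ` fst c" for c
  have 1: "{j (Inr x)} \<in> e c \<longleftrightarrow> x \<in> fst c" for x c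
  proof -
    have "{j (Inr x)} \<noteq> j ` Inl ` X" for X
      using injD[OF j] by (metis Inl_Inr_False imageE insertI1)
    then show ?thesis
      unfolding e_def using injD[OF j] by auto
  qed
  have 2: "j ` Inl ` X \<in> e c \<longleftrightarrow> X \<in> snd c" for X c
  proof -
    have "j ` Inl ` X \<noteq> {j (Inr x)}" for x
      using injD[OF j] by (metis Inl_Inr_False imageE insertI1)
    moreover have "j ` Inl ` X = j ` Inl ` Y \<Longrightarrow> X = Y" for Y
      by (simp add: inj_image_eq_iff[OF j] inj_image_eq_iff)
    ultimately show ?thesis
      unfolding e_def by auto
  qed
  have "inj e"
  proof (rule injI)
    fix c d assume "e c = e d"
    then have "fst c = fst d" "snd c = snd d"
      using 1 2 by blast+
    then show "c = d"
      by (rule prod_eqI)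
  qed
  then show ?thesis
    by (rule that)
qed

section \<open>Criteria for the forced statements\<close>

lemma forcing_poset_refl: "forcing_poset r \<Longrightarrow> p \<in> Field r \<Longrightarrow> (p, p) \<in> r"
  unfolding forcing_poset_def partial_order_on_def preorder_on_def refl_on_def by blast

lemma forcing_poset_trans: "forcing_poset r \<Longrightarrow> (p, q) \<in> r \<Longrightarrow> (q, s) \<in> r \<Longrightarrow> (p, s) \<in> r"
  unfolding forcing_poset_def partial_order_on_def preorder_on_def by (blast dest: transD)

lemma f_mem_mono: "forcing_poset r \<Longrightarrow> f_mem r a \<tau> p \<Longrightarrow> (q, p) \<in> r \<Longrightarrow> f_mem r a \<tau> q"
  unfolding f_mem_def using forcing_poset_trans by metis

text \<open>If a name for a map of \<open>{..<\<alpha>}\<close> onto \<open>\<omega>\<^sub>2\<close>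
  had all its decided values bounded by \<open>\<gamma>\<close> below one condition, surjectivity
  would still let a further extension decide a value above \<open>\<gamma>\<close>.\<close>

lemma preserves_omega2I:
  fixes r :: "'p rel"
  assumes r: "forcing_poset r"
    and bd: "\<And>r0 (J :: omega2 set) (V :: omega2 \<Rightarrow> omega2 \<Rightarrow> 'p \<Rightarrow> bool). r0 \<in> Field r \<Longrightarrow> small J \<Longrightarrow>
      (\<And>i y p q. V i y p \<Longrightarrow> (q, p) \<in> r \<Longrightarrow> V i y q) \<Longrightarrow>
      (\<And>i y z p. (p, r0) \<in> r \<Longrightarrow> V i y p \<Longrightarrow> V i z p \<Longrightarrow> y = z) \<Longrightarrow>
      \<exists>q \<gamma>. (q, r0) \<in> r \<and> (\<forall>p i y. (p, q) \<in> r \<longrightarrow> i \<in> J \<longrightarrow> V i y p \<longrightarrow> y \<le> \<gamma>)"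
  shows "preserves_omega2 r"
  unfolding preserves_omega2_def forced_def f_not_def
proof (intro allI ballI impI notI)
  fix \<alpha> :: omega2 and \<tau> :: "(omega2 \<times> omega2, 'p) subset_name" and p r0
  assume "(r0, p) \<in> r" and bij: "f_bijection r {..<\<alpha>} UNIV \<tau> r0"
  then have r0: "r0 \<in> Field r"
    by (auto simp: Field_def)
  \<comment> \<open>The conjunct \<open>i \<in> {..<\<alpha>}\<close> makes uniqueness of values
    hold for every \<open>i\<close>, also outside the domain of the named function.\<close>
  define V where "V i y p \<longleftrightarrow> i \<in> {..<\<alpha>} \<and> f_mem r (i, y) \<tau> p" for i y p
  have V_fun: "y = z" if "(p, r0) \<in> r" "V i y p" "V i z p" for i y z p
  proof -
    have "f_imp r (f_and (f_mem r (i, y) \<tau>) (f_mem r (i, z) \<tau>)) (f_ground (y = z)) r0"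
      using bij that(2) unfolding f_bijection_def f_function_def f_and_def f_all_def V_def by blast
    then show ?thesis
      using that unfolding f_imp_def f_not_def f_and_def f_ground_def V_def by blast
  qed
  have V_mono: "V i y q" if "V i y p" "(q, p) \<in> r" for i y p q
    using that by (auto simp: V_def intro: f_mem_mono[OF r])
  obtain q \<gamma> where q: "(q, r0) \<in> r" "\<And>p i y. (p, q) \<in> r \<Longrightarrow> i \<in> {..<\<alpha>} \<Longrightarrow> V i y p \<Longrightarrow> y \<le> \<gamma>"
    using bd[OF r0 small_lessThan_omega2[of \<alpha>], of V] V_mono V_fun by blast
  obtain y where y: "\<gamma> < y"
    using exists_greater_omega2 by blast
  have "f_ex r {..<\<alpha>} (\<lambda>x. f_mem r (x, y) \<tau>) r0"
    using bij unfolding f_bijection_def f_surjective_def f_and_def f_all_def by blast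
  then obtain x p where "x \<in> {..<\<alpha>}" "(p, q) \<in> r" "f_mem r (x, y) \<tau> p"
    using q(1) unfolding f_ex_def f_not_def f_all_def by blast
  then have "y \<le> \<gamma>"
    using q(2) unfolding V_def by blast
  then show False
    using y by simp
qed

text \<open>The name \<open>l\<close> is the union of the pieces \<open>P p\<close> over the generic
  filter. Finitely many points forced into \<open>l\<close> lie together in the piece of a single
  extension (\<open>ext\<close>), so the properties of single pieces carry over to
  \<open>l\<close>.\<close>

lemma adds_rainbow_partitionI:
  fixes r :: "'p rel" and P :: "'p \<Rightarrow> (omega2 \<times> omega1) set"
  assumes r: "forcing_poset r" and f: "normal_coloring f"
    and mono: "\<And>p q. (q, p) \<in> r \<Longrightarrow> P p \<subseteq> P q"
    and P: "\<And>p. p \<in> Field r \<Longrightarrow> single_valued (P p)" "\<And>p. p \<in> Field r \<Longrightarrow> no_twins f (P p)"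
    and dense: "\<And>p x. p \<in> Field r \<Longrightarrow> \<exists>q. (q, p) \<in> r \<and> x \<in> Domain (P q)"
  shows "adds_rainbow_partition r f"
proof -
  define l where "l = {(z, p). p \<in> Field r \<and> z \<in> P p}"
  have fld: "q \<in> Field r" if "(q, p) \<in> r" for p q
    using that by (auto simp: Field_def)
  have in_l: "f_mem r z l p" if "z \<in> P p" "p \<in> Field r" for z p
    unfolding f_mem_def
  proof (intro allI impI)
    fix q assume "(q, p) \<in> r"
    then show "\<exists>q'. (q', q) \<in> r \<and> (\<exists>s. (z, s) \<in> l \<and> (q', s) \<in> r)"
      using that fld forcing_poset_refl[OF r] unfolding l_def by blast
  qed
  have ext: "\<exists>q. (q, p) \<in> r \<and> (\<forall>z\<in>Z. z \<in> P q)"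
    if "finite Z" "p \<in> Field r" "\<forall>z\<in>Z. f_mem r z l p" for Z p
    using that
  proof (induction Z)
    case empty
    then show ?case
      using forcing_poset_refl[OF r] by blast
  next
    case (insert z Z)
    then obtain q where q: "(q, p) \<in> r" "\<forall>z\<in>Z. z \<in> P q"
      by blast
    then obtain q' s where q': "(q', q) \<in> r" "(z, s) \<in> l" "(q', s) \<in> r"
      using insert.prems(2) unfolding f_mem_def by blast
    then have "\<forall>z\<in>insert z Z. z \<in> P q'"
      using q(2) mono[OF q'(1)] mono[OF q'(3)] unfolding l_def by blast
    then show ?case
      using forcing_poset_trans[OF r q'(1) q(1)] by blast
  qed
  have "f_function r UNIV UNIV l p" if p: "p \<in> Field r" for p
    unfolding f_function_def f_all_def f_and_def
  proof (intro ballI conjI)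
    fix x
    show "f_ex r UNIV (\<lambda>y. f_mem r (x, y) l) p"
      unfolding f_ex_def f_not_def f_all_def
    proof (intro allI impI notI)
      fix q assume q: "(q, p) \<in> r" and none: "\<forall>a\<in>UNIV. \<forall>s. (s, q) \<in> r \<longrightarrow> \<not> f_mem r (x, a) l s"
      obtain s where "(s, q) \<in> r" "x \<in> Domain (P s)"
        using dense[OF fld[OF q]] by blast
      then show False
        using none in_l fld by blast
    qed
    fix y z
    show "f_imp r (\<lambda>p. f_mem r (x, y) l p \<and> f_mem r (x, z) l p) (f_ground (y = z)) p"
      unfolding f_imp_def f_not_def f_and_def f_ground_def
    proof (intro allI impI notI)
      fix q assume q: "(q, p) \<in> r"
        "(f_mem r (x, y) l q \<and> f_mem r (x, z) l q) \<and> (\<forall>s. (s, q) \<in> r \<longrightarrow> y \<noteq> z)"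
      then obtain s where s: "(s, q) \<in> r" "\<forall>z\<in>{(x, y), (x, z)}. z \<in> P s"
        using ext[of "{(x, y), (x, z)}" q] fld by blast
      then have "y = z"
        using single_valuedD[OF P(1)[OF fld[OF s(1)]]] by blast
      then show False
        using q(2) s(1) by blast
    qed
  qed
  moreover have "f_rainbow r f (\<lambda>x. f_mem r (x, i) l) p" if "p \<in> Field r" for i p
    unfolding f_rainbow_def f_all_def f_imp_def f_not_def f_and_def f_ground_def
  proof (intro ballI allI impI notI)
    fix u v q
    assume uv: "u \<in> pairs UNIV" "v \<in> pairs UNIV" and q: "(q, p) \<in> r"
      and A: "((\<forall>x\<in>u. f_mem r (x, i) l q) \<and> (\<forall>x\<in>v. f_mem r (x, i) l q) \<and> f u = f v) \<and>
        (\<forall>s. (s, q) \<in> r \<longrightarrow> u \<noteq> v)"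
    have "finite u" "finite v"
      using uv by (auto simp: pairs_def intro: card_ge_0_finite)
    then obtain s where s: "(s, q) \<in> r" "\<forall>z\<in>(\<lambda>x. (x, i)) ` (u \<union> v). z \<in> P s"
      using ext[of "(\<lambda>x. (x, i)) ` (u \<union> v)" q] fld[OF q] A by blast
    then have "u = v"
      using rainbow_pairs[OF f P(2)[OF fld[OF s(1)]] uv, of i] A by blast
    then show False
      using A s(1) by blast
  qed
  ultimately show ?thesis
    unfolding adds_rainbow_partition_def forced_def f_and_def f_all_def by blast
qed

section \<open>The poset and the conclusion\<close>

context promises
begin

lemma forcing_exists:
  fixes e :: "'t cond \<Rightarrow> 'p"
  assumes game: "\<And>(\<X> :: (omega2 \<Rightarrow> omega2) set) (\<alpha> :: omega1).
           |\<X>| =o |UNIV :: omega2 set| \<Longrightarrow> (\<forall>g\<in>\<X>. regressive g) \<Longrightarrow>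
           \<exists>I. ideal_on_omega2 I \<and> lt_omega2_complete I \<and> E_omega \<in> I \<and>
             II_has_winning_strategy \<alpha> I \<X>"
    and normal: "normal_coloring f" and e: "inj e"
  shows "\<exists>r :: 'p rel. forcing_poset r \<and> countably_closed r \<and> preserves_omega2 r \<and>
    adds_rainbow_partition r f"
proof -
  define r where "r = {(e c, e d) |c d. c \<in> conds \<and> d \<in> conds \<and> c \<preceq> d}"
  have r_iff: "(e c, e d) \<in> r \<longleftrightarrow> c \<in> conds \<and> d \<in> conds \<and> c \<preceq> d" for c d
    unfolding r_def using injD[OF e] by blast
  have rE: "\<exists>c d. p = e c \<and> q = e d \<and> c \<in> conds \<and> d \<in> conds \<and> c \<preceq> d" if "(p, q) \<in> r" for p q
    using that by (auto simp: r_def)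
  have Field: "Field r = e ` conds"
  proof (intro set_eqI iffI)
    fix p assume "p \<in> Field r"
    then show "p \<in> e ` conds"
      unfolding Field_def using rE by blast
  next
    fix p assume "p \<in> e ` conds"
    then obtain c where "p = e c" "c \<in> conds"
      by blast
    then have "(p, p) \<in> r"
      using r_iff le_refl by simp
    then show "p \<in> Field r"
      unfolding Field_def by blast
  qed
  have poset: "forcing_poset r"
    unfolding forcing_poset_def partial_order_on_def preorder_on_def
  proof (intro conjI)
    show "r \<subseteq> Field r \<times> Field r"
      by (auto simp: Field_def)
    show "refl_on (Field r) r"
      unfolding Field refl_on_def using le_refl r_iff by blast
    show "trans r"
    proof (rule transI)
      fix p q s assume "(p, q) \<in> r" "(q, s) \<in> r"
      then obtain c d d' u where "p = e c" "q = e d" "q = e d'" "s = e u" "c \<in> conds" "u \<in> conds"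
        "c \<preceq> d" "d' \<preceq> u"
        using rE by metis
      then show "(p, s) \<in> r"
        using injD[OF e] le_trans r_iff by metis
    qed
    show "antisym r"
    proof (rule antisymI)
      fix p q assume "(p, q) \<in> r" "(q, p) \<in> r"
      then obtain c d where "p = e c" "q = e d" "c \<preceq> d" "d \<preceq> c"
        using rE r_iff by metis
      then show "p = q"
        using le_antisym by blast
    qed
    show "Field r \<noteq> {}"
      unfolding Field using part_empty by (auto simp: conds_def)
  qed
  moreover have "countably_closed r"
    unfolding countably_closed_def
  proof (intro allI impI)
    fix s assume s: "(\<forall>n. s n \<in> Field r) \<and> (\<forall>n. (s (Suc n), s n) \<in> r)"
    then have "\<forall>n. \<exists>c. s n = e c \<and> c \<in> conds"
      unfolding Field by blast
    then obtain c where c: "\<And>n. s n = e (c n)" "\<And>n. c n \<in> conds"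
      by metis
    have "c (Suc n) \<preceq> c n" for n
    proof -
      have "(e (c (Suc n)), e (c n)) \<in> r"
        using s by (simp add: c(1))
      then show ?thesis
        by (simp add: r_iff)
    qed
    then have "\<exists>q\<in>conds. \<forall>n. q \<preceq> c n"
      by (rule countably_closed_conds[OF c(2)])
    then obtain q where "q \<in> conds" "\<forall>n. q \<preceq> c n"
      by blast
    then have "\<forall>n. (e q, s n) \<in> r"
      using c r_iff by simp
    then show "\<exists>q. \<forall>n. (q, s n) \<in> r"
      by blast
  qed
  moreover have "preserves_omega2 r"
  proof (rule preserves_omega2I[OF poset])
    fix r0 and J :: "omega2 set" and V :: "omega2 \<Rightarrow> omega2 \<Rightarrow> 'p \<Rightarrow> bool"
    assume r0: "r0 \<in> Field r" and J: "small J"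
      and V_mono: "\<And>i y p q. V i y p \<Longrightarrow> (q, p) \<in> r \<Longrightarrow> V i y q"
      and V_fun: "\<And>i y z p. (p, r0) \<in> r \<Longrightarrow> V i y p \<Longrightarrow> V i z p \<Longrightarrow> y = z"
    obtain c0 where c0: "r0 = e c0" "c0 \<in> conds"
      using r0 unfolding Field by blast
    \<comment> \<open>Decisions about codes are pulled back along \<open>e\<close>; the conjunct
      \<open>c \<in> conds\<close> supplies the membership needed to pass from
      \<open>\<preceq>\<close> to \<open>r\<close> in \<open>W_mono\<close>.\<close>
    define W where "W i y c \<longleftrightarrow> c \<in> conds \<and> V i y (e c)" for i y c
    have W_mono: "W i y c'" if "W i y c" "c' \<in> conds" "c' \<preceq> c" for i y c c'
      using that V_mono r_iff unfolding W_def by blast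
    have W_fun: "y = z" if "c \<in> conds" "c \<preceq> c0" "W i y c" "W i z c" for i y z c
      using that V_fun c0 r_iff unfolding W_def by blast
    have "\<exists>q \<gamma>. q \<in> conds \<and> q \<preceq> c0 \<and>
      (\<forall>c i y. c \<in> conds \<longrightarrow> c \<preceq> q \<longrightarrow> i \<in> J \<longrightarrow> W i y c \<longrightarrow> y \<le> \<gamma>)"
    proof (rule bounded_decision[of c0 W J])
      show "\<exists>I. ideal_on_omega2 I \<and> lt_omega2_complete I \<and> E_omega \<in> I \<and>
          II_has_winning_strategy \<alpha> I \<X>"
        if "|\<X>| =o |UNIV :: omega2 set|" "\<forall>g\<in>\<X>. regressive g" for \<X> \<alpha>
        using that by (rule game)
      show "y = z" if "c \<in> conds" "c \<preceq> c0" "W i y c" "W i z c" for i y z c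
        using that by (rule W_fun)
      show "W i y c'" if "W i y c" "c' \<in> conds" "c' \<preceq> c" for i y c c'
        using that by (rule W_mono)
    qed (use c0(2) J in blast)+
    then obtain q \<gamma> where q: "q \<in> conds" "q \<preceq> c0"
      "\<And>c i y. c \<in> conds \<Longrightarrow> c \<preceq> q \<Longrightarrow> i \<in> J \<Longrightarrow> W i y c \<Longrightarrow> y \<le> \<gamma>"
      by blast
    have "y \<le> \<gamma>" if p: "(p, e q) \<in> r" and i: "i \<in> J" and V: "V i y p" for p i y
    proof -
      obtain c d where c: "p = e c" "e q = e d" "c \<in> conds" "c \<preceq> d"
        using rE[OF p] by blast
      then have "c \<preceq> q"
        using injD[OF e c(2)] by simp
      with c show ?thesis
        using q(3) i V unfolding W_def by blast
    qed
    moreover have "(e q, r0) \<in> r"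
      using q c0 r_iff by simp
    ultimately show "\<exists>q \<gamma>. (q, r0) \<in> r \<and> (\<forall>p i y. (p, q) \<in> r \<longrightarrow> i \<in> J \<longrightarrow> V i y p \<longrightarrow> y \<le> \<gamma>)"
      by blast
  qed
  moreover have "adds_rainbow_partition r f"
  proof (rule adds_rainbow_partitionI[OF poset normal, where P = "\<lambda>p. fst (inv e p)"])
    show "fst (inv e p) \<subseteq> fst (inv e q)" if "(q, p) \<in> r" for p q
      using rE[OF that] inv_f_f[OF e] unfolding le_def by force
    show "single_valued (fst (inv e p))" "no_twins f (fst (inv e p))" if "p \<in> Field r" for p
      using that inv_f_f[OF e] by (auto simp: Field conds_def part_def)
    show "\<exists>q. (q, p) \<in> r \<and> x \<in> Domain (fst (inv e q))" if p: "p \<in> Field r" for p x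
    proof -
      obtain c where c: "p = e c" "c \<in> conds"
        using p unfolding Field by blast
      obtain p' where "(p', snd c) \<in> conds" "(p', snd c) \<preceq> c" "x \<in> Domain p'"
        using dense_Domain[of "fst c" "snd c" x] c(2) by auto
      then show ?thesis
        using c r_iff inv_f_f[OF e] by (intro exI[of _ "e (p', snd c)"]) simp
    qed
  qed
  ultimately show ?thesis
    by blast
qed

end

theorem theorem3p10:
  fixes f :: "omega2 set \<Rightarrow> omega2"
  assumes "CH"
    and "\<And>(\<X> :: (omega2 \<Rightarrow> omega2) set) (\<alpha> :: omega1).
           |\<X>| =o |UNIV :: omega2 set| \<Longrightarrow> (\<forall>g\<in>\<X>. regressive g) \<Longrightarrow>
           \<exists>I. ideal_on_omega2 I \<and> lt_omega2_complete I \<and> E_omega \<in> I \<and>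
             II_has_winning_strategy \<alpha> I \<X>"
    and "normal_coloring f" and "omega_bounded f"
  shows "\<exists>r :: omega2 set set rel.
           forcing_poset r \<and> countably_closed r \<and> preserves_omega2 r \<and>
           adds_rainbow_partition r f"
proof -
  obtain gam :: "omega2 set \<Rightarrow> omega2" and bnd :: "omega2 set \<Rightarrow> omega2 \<Rightarrow> omega2"
    and low :: "omega2 set \<Rightarrow> omega2 set set"
    where "\<And>t. small (low t)"
      "\<And>N \<gamma> h. small N \<Longrightarrow> N \<noteq> {} \<Longrightarrow> \<exists>t. gam t = \<gamma> \<and> bnd t = h \<and> low t = N"
    by (rule promise_coding) blast
  then interpret promises gam bnd low f
    using assms(1,4) by unfold_locales
  obtain e :: "(omega2 \<times> omega1) set \<times> omega2 set set \<Rightarrow> omega2 set set" where "inj e"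
    using cond_coding .
  then show ?thesis
    using forcing_exists[OF assms(2,3)] by blast
qed

end
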